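(* Let $n\ge 3$, let $k$ be a field whose characteristic does not divide $n!$, let $S=k[x_1,\dots,x_n]$ with the permutation action of $S_n$, let $\lambda\vdash n$ and let $P\in \mathrm{ST}(\lambda)$. Let $N^P$ be the span of $\{F_T^P: T\in \mathrm{ST}(\lambda)\}$ and $M^P$ the span of $\{H_T^P: T\in \mathrm{ST}(\lambda)\}$ (over $k$, in $S$). Then $N^P$ is an $S_n$-subrepresentation of $S$ isomorphic to $M^P$.
   Context: $S_n$ acts on $S$ by $(\pi\cdot f)(x_1,\dots,x_n)=f(x_{\pi(1)},\dots,x_{\pi(n)})$. Tableaux. A Young tableau $T$ of shape $\lambda\vdash n$ is a filling of the Young diagram of $\lambda$ (English convention, left-justified rows) by $1,\dots,n$, each used once; it is standard if entries strictly increase along rows and down columns. $\mathrm{ST}(\lambda)$ is the set of standard tableaux of shape $\lambda$ and $f^\lambda=|\mathrm{ST}(\lambda)|$. Index. For $P\in \mathrm{ST}(\lambda)$ the word $w(P)$ is obtained by reading each column from bottom to top, starting with the leftmost column. The index of the numbers is defined inductively: $1$ has index $0$; if $j$ has index $p$ then $j+1$ has index $p$ if $j+1$ is to the right of $j$ in $w(P)$, and index $p+1$ if it is to the left. $i(P)$ is the filling of $\lambda$ obtained by replacing each entry of $P$ by its index. Young symmetrizers. $R(T)$ and $C(T)$ are the subgroups of $S_n$ preserving the rows, respectively columns, of $T$ (as sets). Put $r_T=\sum_{\pi\in R(T)}\pi$, $c_T=\sum_{\rho\in C(T)}\mathrm{sgn}(\rho)\rho$, $\varepsilon_T=\frac{f^\lambda}{n!}c_Tr_T$,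 $\sigma_T=\frac{f^\lambda}{n!}r_Tc_T$ in $kS_n$. For $T,P\in \mathrm{ST}(\lambda)$ let $x_T^P=\prod_{c} x_{T(c)}^{\,i(P)(c)}$, the product over all cells $c$ of $\lambda$. Then $F_T^P=\varepsilon_T\cdot x_T^P$ (higher Specht polynomials) and $H_T^P=\sigma_T\cdot x_T^P$ (modified higher Specht polynomials). *)

theory Defs
  imports
    "HOL-Library.Poly_Mapping"
    "HOL-Library.FuncSet"
    "HOL-Combinatorics.Permutations"
    "HOL-Computational_Algebra.Computational_Algebra"
begin

section \<open>The polynomial ring and the action of the symmetric group\<close>

text \<open>A monomial is its finitely supported exponent vector, indexed by all natural numbers;
  \<open>poly_ring n\<close> consists of the polynomials in which only \<open>x\<^sub>1, \<dots>, x\<^sub>n\<close> occur.\<close>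

type_synonym 'k mpol = "(nat \<Rightarrow>\<^sub>0 nat) \<Rightarrow>\<^sub>0 'k"

definition Const :: "'k::comm_ring_1 \<Rightarrow> 'k mpol" where
  "Const a = Poly_Mapping.single 0 a"

definition Var :: "nat \<Rightarrow> 'k::comm_ring_1 mpol" where
  "Var i = Poly_Mapping.single (Poly_Mapping.single i 1) 1"

definition poly_ring :: "nat \<Rightarrow> 'k::comm_ring_1 mpol set" where
  "poly_ring n = {f. \<forall>m \<in> Poly_Mapping.keys f. Poly_Mapping.keys m \<subseteq> {1..n}}"

definition poly_scale :: "'k::comm_ring_1 \<Rightarrow> 'k mpol \<Rightarrow> 'k mpol" where
  "poly_scale a f = Const a * f"

global_interpretation mpol: vector_space "poly_scale :: 'k::field \<Rightarrow> 'k mpol \<Rightarrow> 'k mpol"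
  by standard
    (simp_all add: poly_scale_def Const_def single_add mult_single algebra_simps
      flip: mult.assoc)

definition poly_subst :: "(nat \<Rightarrow> 'k::comm_ring_1 mpol) \<Rightarrow> 'k mpol \<Rightarrow> 'k mpol" where
  "poly_subst g f =
    (\<Sum>m \<in> Poly_Mapping.keys f. Const (Poly_Mapping.lookup f m) *
       (\<Prod>i \<in> Poly_Mapping.keys m. g i ^ Poly_Mapping.lookup m i))"

definition Sym :: "nat \<Rightarrow> (nat \<Rightarrow> nat) set" where
  "Sym n = {\<pi>. \<pi> permutes {1..n}}"

definition perm_act :: "(nat \<Rightarrow> nat) \<Rightarrow> 'k::comm_ring_1 mpol \<Rightarrow> 'k mpol" where
  "perm_act \<pi> f = poly_subst (\<lambda>i. Var (\<pi> i)) f"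

section \<open>The group algebra of the symmetric group\<close>

text \<open>An element of the group algebra of \<open>Sym n\<close> is its coefficient function; only the values
  on \<open>Sym n\<close> matter.\<close>

type_synonym 'k grp_alg = "(nat \<Rightarrow> nat) \<Rightarrow> 'k"

definition ga_mult :: "nat \<Rightarrow> 'k::comm_ring_1 grp_alg \<Rightarrow> 'k grp_alg \<Rightarrow> 'k grp_alg" where
  "ga_mult n a b =
    (\<lambda>\<tau>. \<Sum>\<pi>\<in>Sym n. \<Sum>\<rho>\<in>Sym n. if \<pi> \<circ> \<rho> = \<tau> then a \<pi> * b \<rho> else 0)"

definition ga_scale :: "'k::comm_ring_1 \<Rightarrow> 'k grp_alg \<Rightarrow> 'k grp_alg" where
  "ga_scale s a = (\<lambda>\<pi>. s * a \<pi>)"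

definition ga_act :: "nat \<Rightarrow> 'k::comm_ring_1 grp_alg \<Rightarrow> 'k mpol \<Rightarrow> 'k mpol" where
  "ga_act n a f = (\<Sum>\<pi>\<in>Sym n. poly_scale (a \<pi>) (perm_act \<pi> f))"

section \<open>Partitions and tableaux\<close>

definition partition_of :: "nat list \<Rightarrow> nat \<Rightarrow> bool" where
  "partition_of lam n \<longleftrightarrow> sorted_wrt (\<ge>) lam \<and> 0 \<notin> set lam \<and> sum_list lam = n"

text \<open>Cells are (row, column) pairs, counted from \<open>0\<close>. Tableaux are extensional, so that
  \<open>ST lam\<close> is finite and its cardinality is the number of standard fillings.\<close>

definition cells :: "nat list \<Rightarrow> (nat \<times> nat) set" where
  "cells lam = {(i, j). i < length lam \<and> j < lam ! i}"

definition tableaux :: "nat list \<Rightarrow> (nat \<times> nat \<Rightarrow> nat) set" where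
  "tableaux lam =
    {T \<in> extensional (cells lam). bij_betw T (cells lam) {1..sum_list lam}}"

definition ST :: "nat list \<Rightarrow> (nat \<times> nat \<Rightarrow> nat) set" where
  "ST lam = {T \<in> tableaux lam.
     (\<forall>i j j'. (i, j) \<in> cells lam \<and> (i, j') \<in> cells lam \<and> j < j' \<longrightarrow> T (i, j) < T (i, j')) \<and>
     (\<forall>i i' j. (i, j) \<in> cells lam \<and> (i', j) \<in> cells lam \<and> i < i' \<longrightarrow> T (i, j) < T (i', j))}"

definition num_cols :: "nat list \<Rightarrow> nat" where
  "num_cols lam = (if lam = [] then 0 else hd lam)"

definition col_height :: "nat list \<Rightarrow> nat \<Rightarrow> nat" where
  "col_height lam j = length (filter (\<lambda>r. j < r) lam)"

definition reading_word :: "nat list \<Rightarrow> (nat \<times> nat \<Rightarrow> nat) \<Rightarrow> nat list" where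
  "reading_word lam P =
    concat (map (\<lambda>j. map (\<lambda>i. P (i, j)) (rev [0..<col_height lam j])) [0..<num_cols lam])"

definition right_of :: "nat list \<Rightarrow> nat \<Rightarrow> nat \<Rightarrow> bool" where
  "right_of w b a \<longleftrightarrow> (\<exists>p q. p < q \<and> q < length w \<and> w ! p = a \<and> w ! q = b)"

text \<open>The value at \<open>0\<close> is irrelevant, since words contain only positive letters.\<close>

fun word_index :: "nat list \<Rightarrow> nat \<Rightarrow> nat" where
  "word_index w 0 = 0"
| "word_index w (Suc 0) = 0"
| "word_index w (Suc (Suc j)) =
    (if right_of w (Suc (Suc j)) (Suc j) then word_index w (Suc j)
     else word_index w (Suc j) + 1)"

definition index_tableau :: "nat list \<Rightarrow> (nat \<times> nat \<Rightarrow> nat) \<Rightarrow> nat \<times> nat \<Rightarrow> nat" where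
  "index_tableau lam P c = word_index (reading_word lam P) (P c)"

section \<open>Young symmetrizers\<close>

definition row_entries :: "nat list \<Rightarrow> (nat \<times> nat \<Rightarrow> nat) \<Rightarrow> nat \<Rightarrow> nat set" where
  "row_entries lam T i = {T (i, j) | j. (i, j) \<in> cells lam}"

definition col_entries :: "nat list \<Rightarrow> (nat \<times> nat \<Rightarrow> nat) \<Rightarrow> nat \<Rightarrow> nat set" where
  "col_entries lam T j = {T (i, j) | i. (i, j) \<in> cells lam}"

definition row_group :: "nat list \<Rightarrow> (nat \<times> nat \<Rightarrow> nat) \<Rightarrow> (nat \<Rightarrow> nat) set" where
  "row_group lam T =
    {\<pi> \<in> Sym (sum_list lam). \<forall>i. \<pi> ` row_entries lam T i = row_entries lam T i}"

definition col_group :: "nat list \<Rightarrow> (nat \<times> nat \<Rightarrow> nat) \<Rightarrow> (nat \<Rightarrow> nat) set" where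
  "col_group lam T =
    {\<pi> \<in> Sym (sum_list lam). \<forall>j. \<pi> ` col_entries lam T j = col_entries lam T j}"

definition row_sym :: "nat list \<Rightarrow> (nat \<times> nat \<Rightarrow> nat) \<Rightarrow> 'k::comm_ring_1 grp_alg" where
  "row_sym lam T = (\<lambda>\<pi>. if \<pi> \<in> row_group lam T then 1 else 0)"

definition col_antisym :: "nat list \<Rightarrow> (nat \<times> nat \<Rightarrow> nat) \<Rightarrow> 'k::comm_ring_1 grp_alg" where
  "col_antisym lam T = (\<lambda>\<rho>. if \<rho> \<in> col_group lam T then of_int (sign \<rho>) else 0)"

definition young_coeff :: "nat list \<Rightarrow> 'k::field" where
  "young_coeff lam = of_nat (card (ST lam)) / of_nat (fact (sum_list lam))"

definition eps :: "nat list \<Rightarrow> (nat \<times> nat \<Rightarrow> nat) \<Rightarrow> 'k::field grp_alg" where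
  "eps lam T =
    ga_scale (young_coeff lam) (ga_mult (sum_list lam) (col_antisym lam T) (row_sym lam T))"

definition sig :: "nat list \<Rightarrow> (nat \<times> nat \<Rightarrow> nat) \<Rightarrow> 'k::field grp_alg" where
  "sig lam T =
    ga_scale (young_coeff lam) (ga_mult (sum_list lam) (row_sym lam T) (col_antisym lam T))"

section \<open>Higher Specht polynomials\<close>

definition index_monomial ::
    "nat list \<Rightarrow> (nat \<times> nat \<Rightarrow> nat) \<Rightarrow> (nat \<times> nat \<Rightarrow> nat) \<Rightarrow> 'k::comm_ring_1 mpol" where
  "index_monomial lam T P = (\<Prod>c\<in>cells lam. Var (T c) ^ index_tableau lam P c)"

definition higher_specht ::
    "nat list \<Rightarrow> (nat \<times> nat \<Rightarrow> nat) \<Rightarrow> (nat \<times> nat \<Rightarrow> nat) \<Rightarrow> 'k::field mpol" where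
  "higher_specht lam T P = ga_act (sum_list lam) (eps lam T) (index_monomial lam T P)"

definition mod_higher_specht ::
    "nat list \<Rightarrow> (nat \<times> nat \<Rightarrow> nat) \<Rightarrow> (nat \<times> nat \<Rightarrow> nat) \<Rightarrow> 'k::field mpol" where
  "mod_higher_specht lam T P = ga_act (sum_list lam) (sig lam T) (index_monomial lam T P)"

definition N_space :: "nat list \<Rightarrow> (nat \<times> nat \<Rightarrow> nat) \<Rightarrow> 'k::field mpol set" where
  "N_space lam P = mpol.span {higher_specht lam T P | T. T \<in> ST lam}"

definition M_space :: "nat list \<Rightarrow> (nat \<times> nat \<Rightarrow> nat) \<Rightarrow> 'k::field mpol set" where
  "M_space lam P = mpol.span {mod_higher_specht lam T P | T. T \<in> ST lam}"

section \<open>Representations inside the polynomial ring\<close>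

definition subrep :: "nat \<Rightarrow> 'k::field mpol set \<Rightarrow> bool" where
  "subrep n V \<longleftrightarrow> V \<subseteq> poly_ring n \<and> mpol.subspace V \<and>
     (\<forall>\<pi>\<in>Sym n. \<forall>f\<in>V. perm_act \<pi> f \<in> V)"

definition rep_isomorphic :: "nat \<Rightarrow> 'k::field mpol set \<Rightarrow> 'k mpol set \<Rightarrow> bool" where
  "rep_isomorphic n V W \<longleftrightarrow> subrep n V \<and> subrep n W \<and>
     (\<exists>\<phi>. bij_betw \<phi> V W \<and>
        (\<forall>f\<in>V. \<forall>g\<in>V. \<phi> (f + g) = \<phi> f + \<phi> g) \<and>
        (\<forall>a. \<forall>f\<in>V. \<phi> (poly_scale a f) = poly_scale a (\<phi> f)) \<and>
        (\<forall>\<pi>\<in>Sym n. \<forall>f\<in>V. \<phi> (perm_act \<pi> f) = perm_act \<pi> (\<phi> f)))"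

end

theory Submission
  imports Defs
begin

text \<open>Fix \<open>P\<close> and let \<open>c\<close>, \<open>r\<close> be its column antisymmetrizer and row symmetrizer and \<open>x = x\<^sub>P\<^sup>P\<close>.
  Every tableau is \<open>g P\<close> for a permutation \<open>g\<close>, and \<open>F\<close>, \<open>H\<close> at \<open>g P\<close> are the \<open>g\<close>-translates
  of \<open>c r x\<close>, \<open>r c x\<close> up to a common scalar. Garnir relations, for columns and likewise for rows,
  show that the translates at standard tableaux span the cyclic modules generated by \<open>c r x\<close> and
  \<open>r c x\<close>.

  The isomorphism sends \<open>c r x\<close> to \<open>c r c x\<close>. It rests on von Neumann's lemma (\<open>c a r\<close> is a multiple
  of \<open>c r\<close> for every \<open>a\<close> in the group algebra), on Maschke's theorem, and on \<open>c r x \<noteq> 0 \<noteq> r c x\<close>: since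
  the indices increase strictly down the columns, the coefficient of \<open>x\<close> in both polynomials
  is the order of the stabilizer of \<open>x\<close> in the row group. If the scalar vanishes in the field,
  both modules are zero.\<close>


section \<open>The action on polynomials\<close>

text \<open>No dimension count and no classification of irreducible modules enters; the modules are
  compared through annihilators. In \<open>c a r f = k c r f\<close> the scalar \<open>k\<close>
  does not depend on the polynomial \<open>f\<close>. Evaluating one such identity at
  \<open>f = x\<close> and at \<open>f = c x\<close> shows that \<open>a\<close> kills
  \<open>c r x\<close> iff it kills \<open>c r c x\<close>, once submodules killed by
  \<open>c\<close> are known to be zero. For this, a Maschke projection onto the submodule commutes
  with \<open>c\<close> and \<open>r\<close> and carries the vanishing back to the generator. The
  scalars can be cancelled only because the polynomials are nonzero, which depends on
  \<open>x\<close> and not just on the group algebra. The letters of \<open>P\<close> name the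
  cells, so that row and column group consist of fibre-preserving permutations for two coordinates
  with symmetric axioms. With a boolean that selects the sign or the trivial character, each
  argument about \<open>c r\<close> turns into one about \<open>r c\<close> by an exchange. Only the
  strictness of the indices, a property of columns, is asymmetric. The bound on \<open>n\<close>
  gives 2 as a divisor of n!, so a polynomial equal to its own negative is zero.\<close>

abbreviation lookup where "lookup \<equiv> Poly_Mapping.lookup"
abbreviation keys where "keys \<equiv> Poly_Mapping.keys"

definition mon_act :: "(nat \<Rightarrow> nat) \<Rightarrow> (nat \<Rightarrow>\<^sub>0 nat) \<Rightarrow> (nat \<Rightarrow>\<^sub>0 nat)" where
  "mon_act \<pi> m = (\<Sum>i\<in>keys m. Poly_Mapping.single (\<pi> i) (lookup m i))"

lemma lookup_mon_act:
  assumes "bij \<pi>"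
  shows "lookup (mon_act \<pi> m) j = lookup m (inv \<pi> j)"
proof -
  have "lookup (mon_act \<pi> m) j = (\<Sum>i\<in>keys m. if i = inv \<pi> j then lookup m i else 0)"
    unfolding mon_act_def lookup_sum lookup_single when_def
    using assms by (intro sum.cong) (auto simp: bij_inv_eq_iff bij_is_inj bij_is_surj surj_f_inv_f)
  then show ?thesis
    by (simp add: in_keys_iff)
qed

lemma mon_act_comp:
  assumes "bij \<pi>" "bij \<rho>"
  shows "mon_act \<pi> (mon_act \<rho> m) = mon_act (\<pi> \<circ> \<rho>) m"
  using assms by (intro poly_mapping_eqI) (simp add: lookup_mon_act bij_comp o_inv_distrib)

lemma mon_act_id [simp]: "mon_act id m = m"
  by (intro poly_mapping_eqI) (simp add: lookup_mon_act)

lemma mon_act_eq_iff: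
  assumes "bij \<pi>"
  shows "mon_act \<pi> m = m' \<longleftrightarrow> m = mon_act (inv \<pi>) m'"
proof -
  have "inv \<pi> \<circ> \<pi> = id" "\<pi> \<circ> inv \<pi> = id"
    using assms by (auto simp: bij_is_inj bij_is_surj surj_iff[symmetric])
  then show ?thesis
    using mon_act_comp[OF assms bij_imp_bij_inv[OF assms], of m']
      mon_act_comp[OF bij_imp_bij_inv[OF assms] assms, of m] by auto
qed

lemma prod_single:
  "(\<Prod>i\<in>A. Poly_Mapping.single (m i) (1::'k::comm_ring_1)) = Poly_Mapping.single (\<Sum>i\<in>A. m i) 1"
  by (induction A rule: infinite_finite_induct) (simp_all add: mult_single)

lemma Var_power: "(Var i :: 'k::comm_ring_1 mpol) ^ e = Poly_Mapping.single (Poly_Mapping.single i e) 1"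
  by (induction e) (simp_all add: Var_def mult_single flip: single_add)

text \<open>Replaces substitution by a formula for coefficients, from which the laws of the action
  follow by comparing coefficients. Bijectivity keeps distinct monomials from merging.\<close>

lemma lookup_perm_act:
  assumes "bij \<pi>"
  shows "lookup (perm_act \<pi> f) m = lookup f (mon_act (inv \<pi>) m)"
proof -
  have "perm_act \<pi> f = (\<Sum>m\<in>keys f. Poly_Mapping.single (mon_act \<pi> m) (lookup f m))"
    by (simp add: perm_act_def poly_subst_def Var_power prod_single Const_def mult_single mon_act_def)
  then have "lookup (perm_act \<pi> f) m =
      (\<Sum>m'\<in>keys f. if m' = mon_act (inv \<pi>) m then lookup f m' else 0)"
    by (simp add: lookup_sum lookup_single when_def mon_act_eq_iff[OF assms])
  then show ?thesis
    by (simp add: in_keys_iff)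
qed

lemma lookup_poly_scale [simp]: "lookup (poly_scale a f) m = a * lookup f m"
  unfolding poly_scale_def Const_def mult_map_scale_conv_mult[symmetric]
  by (simp add: map.rep_eq when_def)

lemma perm_act_add: "bij \<pi> \<Longrightarrow> perm_act \<pi> (f + g) = perm_act \<pi> f + perm_act \<pi> g"
  by (intro poly_mapping_eqI) (simp add: lookup_perm_act lookup_add)

lemma perm_act_scale: "bij \<pi> \<Longrightarrow> perm_act \<pi> (poly_scale a f) = poly_scale a (perm_act \<pi> f)"
  by (intro poly_mapping_eqI) (simp add: lookup_perm_act)

lemma perm_act_zero [simp]: "perm_act \<pi> 0 = 0"
  by (simp add: perm_act_def poly_subst_def)

lemma perm_act_sum: "bij \<pi> \<Longrightarrow> perm_act \<pi> (\<Sum>i\<in>A. f i) = (\<Sum>i\<in>A. perm_act \<pi> (f i))"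
  by (induction A rule: infinite_finite_induct) (simp_all add: perm_act_add)

lemma perm_act_comp:
  "bij \<pi> \<Longrightarrow> bij \<rho> \<Longrightarrow> perm_act \<pi> (perm_act \<rho> f) = perm_act (\<pi> \<circ> \<rho>) f"
  by (intro poly_mapping_eqI) (simp add: lookup_perm_act bij_comp mon_act_comp bij_imp_bij_inv o_inv_distrib)

lemma perm_act_id [simp]: "perm_act id f = f"
  by (intro poly_mapping_eqI) (simp add: lookup_perm_act)

lemma perm_act_single:
  "bij \<pi> \<Longrightarrow> perm_act \<pi> (Poly_Mapping.single m a) = Poly_Mapping.single (mon_act \<pi> m) a"
  by (intro poly_mapping_eqI) (auto simp: lookup_perm_act lookup_single when_def mon_act_eq_iff)

section \<open>The symmetric group as a set of functions\<close>

lemma Sym_bij: "\<pi> \<in> Sym n \<Longrightarrow> bij \<pi>"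
  by (simp add: Sym_def permutes_bij)

lemma Sym_permutes: "\<pi> \<in> Sym n \<Longrightarrow> \<pi> permutes {1..n}"
  by (simp add: Sym_def)

lemma Sym_comp: "\<pi> \<in> Sym n \<Longrightarrow> \<rho> \<in> Sym n \<Longrightarrow> \<pi> \<circ> \<rho> \<in> Sym n"
  by (simp add: Sym_def permutes_compose)

lemma Sym_inv: "\<pi> \<in> Sym n \<Longrightarrow> inv \<pi> \<in> Sym n"
  by (simp add: Sym_def permutes_inv)

lemma Sym_id [simp]: "id \<in> Sym n"
  by (simp add: Sym_def permutes_id)

lemma finite_Sym [simp]: "finite (Sym n)"
  by (simp add: Sym_def finite_permutations)

lemma card_Sym: "card (Sym n) = fact n"
  by (simp add: Sym_def card_permutations)

lemma Sym_in: "\<pi> \<in> Sym n \<Longrightarrow> \<pi> e \<in> {1..n} \<longleftrightarrow> e \<in> {1..n}"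
  unfolding Sym_def using permutes_in_image[of \<pi> "{1..n}" e] by simp

lemma bij_inv_simps [simp]:
  assumes "bij \<pi>"
  shows "inv \<pi> (\<pi> e) = e" "\<pi> (inv \<pi> e) = e" "inv \<pi> \<circ> \<pi> = id" "\<pi> \<circ> inv \<pi> = id"
    "inv (inv \<pi>) = \<pi>" "bij (inv \<pi>)"
  using assms by (simp_all add: bij_is_inj bij_is_surj surj_f_inv_f inv_inv_eq bij_imp_bij_inv
      surj_iff[symmetric])

lemma Sym_inv_comp:
  assumes "\<pi> \<in> Sym n" "\<rho> \<in> Sym n"
  shows "inv (\<pi> \<circ> \<rho>) = inv \<rho> \<circ> inv \<pi>"
  using assms by (simp add: Sym_bij o_inv_distrib)

lemma bij_cancel [simp]:
  assumes "bij \<pi>"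
  shows "inv \<pi> \<circ> (\<pi> \<circ> g) = g" "\<pi> \<circ> (inv \<pi> \<circ> g) = g" "g \<circ> \<pi> \<circ> inv \<pi> = g" "g \<circ> inv \<pi> \<circ> \<pi> = g"
  using assms by (auto simp: fun_eq_iff)

lemma poly_ring_perm_act:
  assumes "\<pi> \<in> Sym n" "f \<in> poly_ring n"
  shows "perm_act \<pi> f \<in> poly_ring n"
  unfolding poly_ring_def
proof safe
  fix m i
  assume m: "m \<in> keys (perm_act \<pi> f)" and i: "i \<in> keys m"
  have "mon_act (inv \<pi>) m \<in> keys f"
    using m assms by (simp add: in_keys_iff lookup_perm_act Sym_bij)
  moreover have "inv \<pi> i \<in> keys (mon_act (inv \<pi>) m)"
    using i Sym_bij[OF Sym_inv[OF assms(1)]] assms(1) by (simp add: in_keys_iff lookup_mon_act)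
  ultimately have "inv \<pi> i \<in> {1..n}"
    using assms(2) unfolding poly_ring_def by blast
  then show "i \<in> {1..n}"
    using Sym_in[OF Sym_inv[OF assms(1)]] by blast
qed

lemma subspace_poly_ring: "mpol.subspace (poly_ring n :: 'k::field mpol set)"
proof (rule mpol.subspaceI)
  fix f g :: "'k mpol" and a :: 'k
  assume f: "f \<in> poly_ring n"
  then show "poly_scale a f \<in> poly_ring n"
    unfolding poly_ring_def by (auto simp: in_keys_iff)
  assume g: "g \<in> poly_ring n"
  show "f + g \<in> poly_ring n"
    using f g keys_add[of f g] unfolding poly_ring_def by blast
qed (simp add: poly_ring_def)

section \<open>Signed sums over permutation groups\<close>

definition perm_group :: "nat \<Rightarrow> (nat \<Rightarrow> nat) set \<Rightarrow> bool" where
  "perm_group n H \<longleftrightarrow> H \<subseteq> Sym n \<and> id \<in> H \<and> (\<forall>\<pi>\<in>H. \<forall>\<rho>\<in>H. \<pi> \<circ> \<rho> \<in> H) \<and> (\<forall>\<pi>\<in>H. inv \<pi> \<in> H)"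

lemma perm_groupD:
  assumes "perm_group n H"
  shows "\<pi> \<in> H \<Longrightarrow> \<pi> \<in> Sym n" "id \<in> H" "\<pi> \<in> H \<Longrightarrow> \<rho> \<in> H \<Longrightarrow> \<pi> \<circ> \<rho> \<in> H" "\<pi> \<in> H \<Longrightarrow> inv \<pi> \<in> H"
    "H \<subseteq> Sym n" "finite H"
  using assms finite_subset[OF _ finite_Sym] unfolding perm_group_def by blast+

lemma perm_group_Sym: "perm_group n (Sym n)"
  by (simp add: perm_group_def Sym_comp Sym_inv)

lemma bij_betw_comp_left:
  assumes "perm_group n H" "h \<in> H"
  shows "bij_betw (\<lambda>\<pi>. h \<circ> \<pi>) H H"
proof (rule bij_betwI[of _ _ _ "\<lambda>\<pi>. inv h \<circ> \<pi>"])
  note D = perm_groupD(3)[OF assms(1)] perm_groupD(4)[OF assms]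
  show "(\<lambda>\<pi>. h \<circ> \<pi>) \<in> H \<rightarrow> H" "(\<lambda>\<pi>. inv h \<circ> \<pi>) \<in> H \<rightarrow> H"
    using D assms(2) by blast+
qed (simp_all add: Sym_bij[OF perm_groupD(1)[OF assms]])

lemma bij_betw_comp_right:
  assumes "perm_group n H" "h \<in> H"
  shows "bij_betw (\<lambda>\<pi>. \<pi> \<circ> h) H H"
proof (rule bij_betwI[of _ _ _ "\<lambda>\<pi>. \<pi> \<circ> inv h"])
  note D = perm_groupD(3)[OF assms(1)] perm_groupD(4)[OF assms]
  show "(\<lambda>\<pi>. \<pi> \<circ> h) \<in> H \<rightarrow> H" "(\<lambda>\<pi>. \<pi> \<circ> inv h) \<in> H \<rightarrow> H"
    using D assms(2) by blast+
qed (simp_all add: Sym_bij[OF perm_groupD(1)[OF assms]])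

text \<open>Lagrange's theorem, by right cosets. It makes the order of each permutation group
  invertible in a field where n! is nonzero.\<close>

lemma card_perm_group_dvd:
  assumes "perm_group n H"
  shows "card H dvd fact n"
proof -
  define coset where "coset g = (\<lambda>h. h \<circ> g) ` H" for g :: "nat \<Rightarrow> nat"
  have "coset g \<subseteq> Sym n" if "g \<in> Sym n" for g
    unfolding coset_def using Sym_comp[OF perm_groupD(1)[OF assms] that] by blast
  moreover have "g \<in> coset g" for g
    unfolding coset_def using perm_groupD(2)[OF assms] by (intro image_eqI[of _ _ id]) auto
  ultimately have "(\<Union>g\<in>Sym n. coset g) = Sym n"
    by blast
  moreover have "card H dvd card (\<Union>(coset ` Sym n))"
  proof (rule dvd_partition)
    show "finite (\<Union>(coset ` Sym n))"
      unfolding coset_def using perm_groupD(6)[OF assms] by simp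
    show "\<forall>c\<in>coset ` Sym n. card H dvd card c"
    proof safe
      fix g assume g: "g \<in> Sym n"
      have "inj_on (\<lambda>h. h \<circ> g) H"
        by (rule inj_on_inverseI[of _ "\<lambda>h. h \<circ> inv g"]) (simp add: Sym_bij[OF g])
      then show "card H dvd card (coset g)"
        by (simp add: coset_def card_image)
    qed
    have "coset g = coset g'"
      if "g \<in> Sym n" "g' \<in> Sym n" "x \<in> coset g" "x \<in> coset g'" for g g' x
    proof -
      have *: "coset a \<subseteq> coset b"
        if x: "x \<in> coset a" "x \<in> coset b" "a \<in> Sym n" "b \<in> Sym n" for a b
      proof -
        obtain h k where h: "x = h \<circ> a" "h \<in> H" and k: "x = k \<circ> b" "k \<in> H"
          using x unfolding coset_def by blast
        have "a = inv h \<circ> (h \<circ> a)"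
          using Sym_bij[OF perm_groupD(1)[OF assms h(2)]] by simp
        also have "\<dots> = (inv h \<circ> k) \<circ> b"
          using h k by (simp add: comp_assoc)
        finally have a: "a = (inv h \<circ> k) \<circ> b" .
        have "l \<circ> a \<in> coset b" if "l \<in> H" for l
          unfolding coset_def a comp_assoc[symmetric]
          by (intro imageI perm_groupD(3)[OF assms] perm_groupD(4)[OF assms] h k that)
        then show ?thesis
          unfolding coset_def[of a] by blast
      qed
      then show ?thesis
        using that by blast
    qed
    then show "\<forall>c1\<in>coset ` Sym n. \<forall>c2\<in>coset ` Sym n. c1 \<noteq> c2 \<longrightarrow> c1 \<inter> c2 = {}"
      by blast
  qed
  ultimately show ?thesis
    by (simp add: card_Sym)
qed

text \<open>The boolean selects the sign or the trivial character, so that antisymmetrizers and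
  symmetrizers become instances of one operator \<open>sym_op\<close>.\<close>

definition ch :: "bool \<Rightarrow> (nat \<Rightarrow> nat) \<Rightarrow> 'k::comm_ring_1" where
  "ch b \<pi> = (if b then of_int (sign \<pi>) else 1)"

lemma Sym_permutation: "\<pi> \<in> Sym n \<Longrightarrow> permutation \<pi>"
  unfolding Sym_def permutation_permutes by auto

lemma ch_comp: "\<pi> \<in> Sym n \<Longrightarrow> \<rho> \<in> Sym n \<Longrightarrow> ch b (\<pi> \<circ> \<rho>) = ch b \<pi> * ch b \<rho>"
  by (simp add: ch_def sign_compose Sym_permutation)

lemma ch_inv: "\<pi> \<in> Sym n \<Longrightarrow> ch b (inv \<pi>) = ch b \<pi>"
  by (simp add: ch_def sign_inverse Sym_permutation)

lemma ch_square [simp]: "ch b \<pi> * ch b \<pi> = 1"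
  by (simp add: ch_def flip: of_int_mult)

lemma ch_square_left [simp]: "ch b \<pi> * (ch b \<pi> * x) = x"
  by (simp flip: mult.assoc)

definition sym_op :: "bool \<Rightarrow> (nat \<Rightarrow> nat) set \<Rightarrow> 'k::field mpol \<Rightarrow> 'k mpol" where
  "sym_op b H f = (\<Sum>\<pi>\<in>H. poly_scale (ch b \<pi>) (perm_act \<pi> f))"

lemma sym_op_zero [simp]: "sym_op b H 0 = 0"
  by (simp add: sym_op_def)

lemma sym_op_scale: "H \<subseteq> Sym n \<Longrightarrow> sym_op b H (poly_scale a f) = poly_scale a (sym_op b H f)"
  unfolding sym_op_def mpol.scale_sum_right
  by (intro sum.cong) (auto simp: perm_act_scale Sym_bij subset_iff mult.commute)

lemma sym_op_sum:
  assumes "H \<subseteq> Sym n"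
  shows "sym_op b H (\<Sum>i\<in>A. f i) = (\<Sum>i\<in>A. sym_op b H (f i))"
proof -
  have "sym_op b H (\<Sum>i\<in>A. f i) = (\<Sum>\<pi>\<in>H. \<Sum>i\<in>A. poly_scale (ch b \<pi>) (perm_act \<pi> (f i)))"
    unfolding sym_op_def using assms
    by (intro sum.cong) (auto simp: perm_act_sum Sym_bij subset_iff mpol.scale_sum_right)
  also have "\<dots> = (\<Sum>i\<in>A. sym_op b H (f i))"
    unfolding sym_op_def by (rule sum.swap)
  finally show ?thesis .
qed

text \<open>Reindexing the sum by left multiplication with \<open>h\<close> costs the factor
  \<open>ch b h\<close>, which is its own inverse.\<close>

lemma sym_op_absorb_left:
  assumes H: "perm_group n H" and h: "h \<in> H"
  shows "perm_act h (sym_op b H f) = poly_scale (ch b h) (sym_op b H f)"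
proof -
  note [simp] = Sym_bij perm_groupD(1)[OF H]
  have "poly_scale (ch b h) (sym_op b H f) =
      (\<Sum>\<pi>\<in>H. poly_scale (ch b h * ch b (h \<circ> \<pi>)) (perm_act (h \<circ> \<pi>) f))"
    unfolding sym_op_def
    by (subst sum.reindex_bij_betw[OF bij_betw_comp_left[OF H h], symmetric])
       (simp add: mpol.scale_sum_right)
  also have "\<dots> = perm_act h (sym_op b H f)"
    unfolding sym_op_def using h Sym_bij[OF perm_groupD(1)[OF H]]
    by (subst perm_act_sum)
       (auto simp: perm_act_scale perm_act_comp ch_comp[OF perm_groupD(1)[OF H] perm_groupD(1)[OF H]])
  finally show ?thesis ..
qed

lemma sym_op_absorb_right:
  assumes H: "perm_group n H" and h: "h \<in> H"
  shows "sym_op b H (perm_act h f) = poly_scale (ch b h) (sym_op b H f)"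
proof -
  have "poly_scale (ch b h) (sym_op b H f) =
      (\<Sum>\<pi>\<in>H. poly_scale (ch b h * ch b (\<pi> \<circ> h)) (perm_act (\<pi> \<circ> h) f))"
    unfolding sym_op_def
    by (subst sum.reindex_bij_betw[OF bij_betw_comp_right[OF H h], symmetric])
       (simp add: mpol.scale_sum_right)
  also have "\<dots> = sym_op b H (perm_act h f)"
    unfolding sym_op_def using h Sym_bij[OF perm_groupD(1)[OF H]]
    by (intro sum.cong)
       (auto simp: perm_act_comp ch_comp[OF perm_groupD(1)[OF H] perm_groupD(1)[OF H]] mult.commute)
  finally show ?thesis ..
qed

lemma sum_poly_scale_const: "(\<Sum>i\<in>A. f) = poly_scale (of_nat (card A)) (f :: 'k::field mpol)"
proof (induction A rule: infinite_finite_induct)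
  case (insert x F)
  then show ?case by (simp del: sum_constant add: mpol.scale_left_distrib)
qed (simp_all del: sum_constant)

lemma sym_op_idem:
  assumes H: "perm_group n H"
  shows "sym_op b H (sym_op b H f) = poly_scale (of_nat (card H)) (sym_op b H f)"
  unfolding sym_op_def[of b H "sym_op b H f"]
  by (simp del: sum_constant add: sym_op_absorb_left[OF H] sum_poly_scale_const)

text \<open>A character is constant on conjugacy classes. This carries the symmetrizers of the fixed
  tableau to those of its translate by \<open>g\<close>.\<close>

lemma sym_op_conj:
  assumes H: "H \<subseteq> Sym n" and g: "g \<in> Sym n"
  shows "perm_act g (sym_op b H f) = sym_op b ((\<lambda>\<pi>. g \<circ> \<pi> \<circ> inv g) ` H) (perm_act g f)"
proof -
  note bg [simp] = Sym_bij[OF g]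
  have inj: "inj_on (\<lambda>\<pi>. g \<circ> \<pi> \<circ> inv g) H"
    by (rule inj_on_inverseI[of _ "\<lambda>\<pi>. inv g \<circ> \<pi> \<circ> g"]) (simp add: fun_eq_iff)
  have "poly_scale (ch b (g \<circ> \<pi> \<circ> inv g)) (perm_act (g \<circ> \<pi> \<circ> inv g) (perm_act g f)) =
      perm_act g (poly_scale (ch b \<pi>) (perm_act \<pi> f))" if "\<pi> \<in> H" for \<pi>
  proof -
    have p: "\<pi> \<in> Sym n" "bij \<pi>"
      using H that by (auto simp: Sym_bij)
    have "(ch b (g \<circ> \<pi> \<circ> inv g) :: 'a) = ch b \<pi>"
      by (simp add: ch_comp[OF Sym_comp[OF g p(1)] Sym_inv[OF g]] ch_comp[OF g p(1)] ch_inv[OF g] ac_simps)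
    then show ?thesis
      using p by (simp add: perm_act_comp perm_act_scale bij_comp)
  qed
  then show ?thesis
    unfolding sym_op_def sum.reindex[OF inj] perm_act_sum[OF bg] by simp
qed


section \<open>Diagrams on the letters\<close>

text \<open>With \<open>u\<close> the column (row) of a letter in the fixed tableau, this is its
  column (row) group. The condition is pointwise; \<open>setwise_fib_iff\<close> relates it to the
  setwise one.\<close>

definition fib_group :: "nat \<Rightarrow> (nat \<Rightarrow> nat) \<Rightarrow> (nat \<Rightarrow> nat) set" where
  "fib_group n u = {\<pi> \<in> Sym n. \<forall>e\<in>{1..n}. u (\<pi> e) = u e}"

lemma perm_group_fib: "perm_group n (fib_group n u)"
proof -
  have "u (inv \<pi> e) = u e" if "\<pi> \<in> Sym n" "\<forall>e\<in>{1..n}. u (\<pi> e) = u e" "e \<in> {1..n}" for \<pi> e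
    using that(2)[rule_format, of "inv \<pi> e"] that Sym_in[OF Sym_inv[OF that(1)], of e] Sym_bij[OF that(1)]
    by simp
  moreover have "u ((\<pi> \<circ> \<rho>) e) = u e"
    if "\<pi> \<in> fib_group n u" "\<rho> \<in> fib_group n u" "e \<in> {1..n}" for \<pi> \<rho> e
    using that Sym_in[of \<rho> n e] by (simp add: fib_group_def)
  ultimately show ?thesis
    unfolding perm_group_def using Sym_comp Sym_inv Sym_id unfolding fib_group_def by auto
qed

lemma transpose_Sym: "x \<in> {1..n} \<Longrightarrow> y \<in> {1..n} \<Longrightarrow> transpose x y \<in> Sym n"
  unfolding Sym_def by (auto intro: permutes_swap_id)

lemma transpose_fib:
  "x \<in> {1..n} \<Longrightarrow> y \<in> {1..n} \<Longrightarrow> u x = u y \<Longrightarrow> transpose x y \<in> fib_group n u"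
  using transpose_Sym[of x n y] by (auto simp: fib_group_def transpose_def)

lemma perm_group_permutes:
  assumes "Z \<subseteq> {1..n}"
  shows "perm_group n {\<pi>. \<pi> permutes Z}"
  unfolding perm_group_def Sym_def
  using assms by (auto intro: permutes_subset permutes_compose permutes_inv permutes_id)

text \<open>Cancelling the common part leaves nonempty sets of equal size, one lying above the
  maximum of the other. Used for von Neumann's lemma and for the growth of weights in Garnir
  straightening.\<close>

lemma sum_less_exchange:
  fixes A B :: "nat set"
  assumes "finite A" "finite B" "card A = card B" "A \<noteq> B"
    and less: "\<And>a b. a \<in> A - B \<Longrightarrow> b \<in> B - A \<Longrightarrow> b < a"
  shows "\<Sum>B < \<Sum>A"
proof -
  have c: "card (A - B) = card (B - A)"
    using card_Diff_subset_Int[of A B] card_Diff_subset_Int[of B A] assms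
    by (simp add: Int_commute)
  have ne: "A - B \<noteq> {}" "B - A \<noteq> {}"
    using c assms by (metis Diff_eq_empty_iff card_subset_eq card_0_eq finite_Diff order_antisym)+
  define M where "M = Max (B - A)"
  have M: "M \<in> B - A" "\<And>b. b \<in> B - A \<Longrightarrow> b \<le> M"
    unfolding M_def using ne assms(2) by (auto intro!: Max_in[of "B - A", simplified] Max_ge)
  have "\<Sum>(B - A) \<le> card (B - A) * M"
    using sum_bounded_above[of "B - A" "\<lambda>x. x" M] M by simp
  also have "\<dots> < card (A - B) * Suc M"
    using c ne assms(1,2) by (simp add: card_gt_0_iff)
  also have "\<dots> \<le> \<Sum>(A - B)"
    using sum_bounded_below[of "A - B" "Suc M" "\<lambda>x. x"] less M(1) by (simp add: Suc_le_eq)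
  finally have "\<Sum>(B - A) < \<Sum>(A - B)" .
  moreover have "\<Sum>A = \<Sum>(A \<inter> B) + \<Sum>(A - B)" "\<Sum>B = \<Sum>(A \<inter> B) + \<Sum>(B - A)"
    using sum.Int_Diff[of A "\<lambda>x. x" B] sum.Int_Diff[of B "\<lambda>x. x" A] assms by (simp_all add: Int_commute)
  ultimately show ?thesis by simp
qed

text \<open>One step of the rearrangement inequality: the swap gives the larger factor to the larger
  coefficient.\<close>

lemma sum_less_transpose:
  fixes a x :: "nat \<Rightarrow> nat"
  assumes "finite A" "c \<in> A" "c' \<in> A" "a c < a c'" "x c' < x c"
  shows "(\<Sum>e\<in>A. a e * x e) < (\<Sum>e\<in>A. a e * x (transpose c c' e))"
proof -
  have "c \<noteq> c'"
    using assms(4) by auto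
  then have split: "(\<Sum>e\<in>A. f e) = f c + f c' + (\<Sum>e\<in>A - {c, c'}. f e)" for f :: "nat \<Rightarrow> nat"
    using assms by (subst sum.subset_diff[of "{c, c'}" A]) auto
  have "(\<Sum>e\<in>A - {c, c'}. a e * x (transpose c c' e)) = (\<Sum>e\<in>A - {c, c'}. a e * x e)"
    by (intro sum.cong) (auto simp: transpose_def)
  moreover have "a c * x c + a c' * x c' < a c * x c' + a c' * x c"
  proof -
    obtain k l where "a c' = a c + Suc k" "x c = x c' + Suc l"
      using assms(4,5) by (metis less_iff_Suc_add add_Suc_right)
    then show ?thesis by (simp add: algebra_simps)
  qed
  ultimately show ?thesis
    by (simp add: split)
qed

text \<open>The transposition of \<open>x\<close> and \<open>y\<close> is absorbed by the outer
  operator; moved through \<open>g\<close>, it becomes a transposition absorbed by the inner one.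
  The two characters disagree on it.\<close>

lemma sym_op_vanish:
  fixes f :: "'k::field mpol"
  assumes two: "(2::'k) \<noteq> 0" and H: "perm_group n H" and g: "g \<in> Sym n"
    and xy: "x \<noteq> y" "x \<in> {1..n}" "y \<in> {1..n}" "transpose x y \<in> H" "v (inv g x) = v (inv g y)"
  shows "sym_op b H (perm_act g (sym_op (\<not> b) (fib_group n v) f)) = 0"
proof -
  let ?S = "sym_op (\<not> b) (fib_group n v) f" and ?t = "transpose x y"
    and ?s = "transpose (inv g x) (inv g y)"
  have bg: "bij g" "bij ?t"
    using Sym_bij[OF g] by auto
  have s: "?s \<in> fib_group n v"
    using xy Sym_in[OF Sym_inv[OF g]] by (intro transpose_fib) auto
  then have bs: "bij ?s" by simp
  have "g \<circ> ?s = ?t \<circ> g"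
    using bg(1) by (auto simp: fun_eq_iff transpose_def bij_inv_eq_iff)
  then have "perm_act g (perm_act ?s ?S) = perm_act ?t (perm_act g ?S)"
    using bg bs by (simp add: perm_act_comp)
  then have st: "perm_act g (perm_act ?s ?S) = perm_act ?t (perm_act g ?S)"
    using bg bs by (simp add: perm_act_comp)
  let ?E = "sym_op b H (perm_act g ?S)"
  have "poly_scale (ch (\<not> b) ?s) ?E = sym_op b H (perm_act g (perm_act ?s ?S))"
    using bg(1)
    by (simp add: sym_op_absorb_left[OF perm_group_fib s] sym_op_scale[OF perm_groupD(5)[OF H]]
        perm_act_scale)
  also have "\<dots> = poly_scale (ch b ?t) ?E"
    unfolding st by (rule sym_op_absorb_right[OF H xy(4)])
  finally have eq: "poly_scale (ch (\<not> b) ?s) ?E = poly_scale (ch b ?t) ?E" .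
  have "inv g x \<noteq> inv g y"
    using xy(1) bg(1) by (metis bij_inv_simps(2))
  \<comment> \<open>Exactly one of \<open>b\<close> and \<open>\<not> b\<close> selects the sign, so
    exactly one of the two scalars is -1.\<close>
  with eq xy(1) have "?E = - ?E"
    by (cases b) (simp_all add: ch_def sign_swap_id)
  then have "?E + ?E = 0"
    by (metis add.right_inverse)
  then have "poly_scale 2 ?E = 0"
    using mpol.scale_left_distrib[of 1 1 ?E] by simp
  then show ?thesis
    using two by simp
qed

text \<open>The letters of a fixed tableau stand for its cells: \<open>u\<close> and \<open>v\<close> are the column and row of a
  letter, or the row and column, and a tableau of the same shape is a permutation of the letters.\<close>

locale young_coords =
  fixes n :: nat and u v :: "nat \<Rightarrow> nat"
  assumes coords_inj: "\<lbrakk>e \<in> {1..n}; e' \<in> {1..n}; u e = u e'; v e = v e'\<rbrakk> \<Longrightarrow> e = e'"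
    and coords_down: "\<lbrakk>e \<in> {1..n}; i \<le> u e; j \<le> v e\<rbrakk> \<Longrightarrow> \<exists>e'\<in>{1..n}. u e' = i \<and> v e' = j"
begin

text \<open>Conjugation of the diagram; it supplies the row version of every result of the
  locale.\<close>

lemma swap: "young_coords n v u"
  by unfold_locales (use coords_inj coords_down in blast)+

definition line :: "nat \<Rightarrow> nat set" where
  "line i = {e \<in> {1..n}. u e = i}"

lemma line_D: "e \<in> line i \<Longrightarrow> e \<in> {1..n}" "e \<in> line i \<Longrightarrow> u e = i"
  by (auto simp: line_def)

lemma inj_on_line: "inj_on v (line i)"
  by (intro inj_onI) (metis coords_inj line_D)

text \<open>Along each line, the cross coordinates of the translated diagram sum up to at least the sum of
  the initial segment of the same length, and the total sums agree. So equality holds on every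
  line.\<close>

lemma factorization:
  assumes g: "g \<in> Sym n"
    and inj: "\<And>i. inj_on (\<lambda>e. v (inv g e)) (line i)"
  shows "\<exists>\<sigma>\<in>fib_group n u. \<sigma> \<circ> g \<in> fib_group n v"
proof -
  define h where "h e = v (inv g e)" for e
  have fin: "finite (line i)" for i
    by (simp add: line_def)
  have injh: "inj_on h (line i)" for i
    unfolding h_def by (rule inj)
  have strict: "\<Sum>(v ` line i) < \<Sum>(h ` line i)" if "h ` line i \<noteq> v ` line i" for i
  proof (rule sum_less_exchange)
    show "card (h ` line i) = card (v ` line i)"
      by (simp add: card_image[OF injh] card_image[OF inj_on_line])
    fix a b assume a: "a \<in> h ` line i - v ` line i" and b: "b \<in> v ` line i - h ` line i"
    \<comment> \<open>By \<open>coords_down\<close> the image of a line under \<open>v\<close> is an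
      initial segment of the naturals, so a value outside it exceeds all values in it.\<close>
    show "b < a"
    proof (rule ccontr)
      assume "\<not> b < a"
      moreover obtain e where "e \<in> {1..n}" "u e = i" "b = v e"
        using b by (auto simp: line_def)
      ultimately obtain e' where "e' \<in> {1..n}" "u e' = i" "v e' = a"
        using coords_down[of e i a] by auto
      then show False
        using a by (auto simp: line_def)
    qed
  qed (use fin that in auto)
  have sums: "sum v (line i) = \<Sum>(v ` line i)" "sum h (line i) = \<Sum>(h ` line i)" for i
    using sum.reindex[OF inj_on_line, of "\<lambda>x. x"] sum.reindex[OF injh, of "\<lambda>x. x"] by simp_all
  have tot: "(\<Sum>i\<in>u ` {1..n}. sum w (line i)) = sum w {1..n}" for w :: "nat \<Rightarrow> nat"
    unfolding line_def by (rule sum.image_gen[symmetric]) simp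
  have "sum h {1..n} = sum v {1..n}"
    using sum.permute[OF Sym_permutes[OF Sym_inv[OF g]], of v] by (simp add: h_def o_def)
  then have eq0: "(\<Sum>i\<in>u ` {1..n}. sum v (line i)) = (\<Sum>i\<in>u ` {1..n}. sum h (line i))"
    unfolding tot by simp
  have eq: "h ` line i = v ` line i" if i: "i \<in> u ` {1..n}" for i
  proof (rule ccontr)
    assume "h ` line i \<noteq> v ` line i"
    moreover have "sum v (line i) \<le> sum h (line i)" for i
      unfolding sums using strict[of i] by (cases "h ` line i = v ` line i") auto
    ultimately have "(\<Sum>i\<in>u ` {1..n}. sum v (line i)) < (\<Sum>i\<in>u ` {1..n}. sum h (line i))"
      using i strict[of i] unfolding sums by (intro sum_strict_mono_ex1) auto
    then show False
      using eq0 by simp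
  qed
  \<comment> \<open>Each letter can be moved within its own line to the cross coordinate
    \<open>h e\<close>; these moves together form \<open>\<sigma>\<close>.\<close>
  have "\<exists>e'\<in>{1..n}. u e' = u e \<and> v e' = h e" if "e \<in> {1..n}" for e
  proof -
    have "h e \<in> v ` line (u e)"
      using that eq[of "u e"] by (auto simp: line_def)
    then show ?thesis
      by (auto simp: line_def)
  qed
  then obtain s where s: "\<And>e. e \<in> {1..n} \<Longrightarrow> s e \<in> {1..n} \<and> u (s e) = u e \<and> v (s e) = h e"
    by metis
  define \<sigma> where "\<sigma> e = (if e \<in> {1..n} then s e else e)" for e
  have "inj_on \<sigma> {1..n}"
  proof (rule inj_onI)
    fix e e' assume e: "e \<in> {1..n}" "e' \<in> {1..n}" "\<sigma> e = \<sigma> e'"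
    then have "u e = u e'" "h e = h e'"
      using s[of e] s[of e'] by (auto simp: \<sigma>_def)
    then show "e = e'"
      using inj_onD[OF injh[of "u e"], of e e'] e by (auto simp: line_def)
  qed
  moreover have "\<sigma> ` {1..n} \<subseteq> {1..n}"
    using s by (auto simp: \<sigma>_def)
  ultimately have "bij_betw \<sigma> {1..n} {1..n}"
    by (simp add: bij_betw_def endo_inj_surj)
  then have "\<sigma> permutes {1..n}"
    by (intro bij_imp_permutes) (auto simp: \<sigma>_def)
  then have \<sigma>: "\<sigma> \<in> Sym n"
    by (simp add: Sym_def)
  moreover have "u (\<sigma> e) = u e" if "e \<in> {1..n}" for e
    using that s by (simp add: \<sigma>_def)
  moreover have "v (\<sigma> (g e)) = v e" if "e \<in> {1..n}" for e
    using that s[of "g e"] Sym_in[OF g, of e] Sym_bij[OF g] by (simp add: \<sigma>_def h_def)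
  ultimately show ?thesis
    unfolding fib_group_def using Sym_comp[OF \<sigma> g] by auto
qed

text \<open>Von Neumann's lemma for a single permutation. Either \<open>g\<close> factors through
  the two groups and both factors are absorbed with a sign, or two letters of a line come from a
  common cross line and everything vanishes. The order of the quantifiers matters: one
  \<open>k\<close> serves all \<open>f\<close>.\<close>

lemma sandwich:
  assumes two: "(2::'k::field) \<noteq> 0" and g: "g \<in> Sym n"
  shows "\<exists>k::'k. \<forall>f. sym_op b (fib_group n u) (perm_act g (sym_op (\<not> b) (fib_group n v) f)) =
    poly_scale k (sym_op b (fib_group n u) (sym_op (\<not> b) (fib_group n v) f))"
proof (cases "\<forall>i. inj_on (\<lambda>e. v (inv g e)) (line i)")
  case True
  then obtain \<sigma> where \<sigma>: "\<sigma> \<in> fib_group n u" "\<sigma> \<circ> g \<in> fib_group n v"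
    using factorization[OF g] by blast
  have \<sigma>': "inv \<sigma> \<in> fib_group n u"
    using \<sigma>(1) perm_groupD(4)[OF perm_group_fib] by blast
  have b: "bij \<sigma>" "bij g"
    using Sym_bij perm_groupD(1)[OF perm_group_fib \<sigma>(1)] g by blast+
  have "perm_act g f = perm_act (inv \<sigma>) (perm_act (\<sigma> \<circ> g) f)" for f :: "'k mpol"
    using b by (simp add: perm_act_comp bij_comp)
  then show ?thesis
    using b
    by (intro exI[of _ "ch (\<not> b) (\<sigma> \<circ> g) * ch b (inv \<sigma>)"])
       (simp add: sym_op_absorb_left[OF perm_group_fib \<sigma>(2)] perm_act_scale sym_op_scale[OF perm_groupD(5)[OF perm_group_fib]]
         sym_op_absorb_right[OF perm_group_fib \<sigma>'])
next
  case False
  then obtain i x y where "x \<in> line i" "y \<in> line i" "x \<noteq> y" "v (inv g x) = v (inv g y)"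
    by (auto simp: inj_on_def)
  then have "sym_op b (fib_group n u) (perm_act g (sym_op (\<not> b) (fib_group n v) f)) = 0"
    for f :: "'k mpol"
    by (intro sym_op_vanish[OF two perm_group_fib g, of x y])
       (auto simp: line_def intro!: transpose_fib)
  then show ?thesis
    by (intro exI[of _ 0]) simp
qed

end


section \<open>Garnir relations\<close>

text \<open>As letters name cells, this says that applying \<open>g\<close> to the entries of the
  fixed tableau gives a standard tableau.\<close>

definition std_labelling :: "nat \<Rightarrow> (nat \<Rightarrow> nat) \<Rightarrow> (nat \<Rightarrow> nat) \<Rightarrow> (nat \<Rightarrow> nat) \<Rightarrow> bool" where
  "std_labelling n u v g \<longleftrightarrow> (\<forall>e\<in>{1..n}. \<forall>e'\<in>{1..n}.
     (u e = u e' \<and> v e < v e' \<longrightarrow> g e < g e') \<and> (v e = v e' \<and> u e < u e' \<longrightarrow> g e < g e'))"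

lemma std_labelling_commute: "std_labelling n u v g \<longleftrightarrow> std_labelling n v u g"
  unfolding std_labelling_def by blast

context young_coords
begin

text \<open>Along a line through \<open>c\<close>, the letters from \<open>c\<close> onwards together with the letters of the line
  through \<open>c'\<close> up to \<open>c'\<close> outnumber the cross lines that meet them, so that two of them always stay
  on a common cross line.\<close>

lemma garnir_zero:
  fixes f :: "'k::field mpol"
  assumes two: "(2::'k) \<noteq> 0"
    and c: "c \<in> {1..n}" "c' \<in> {1..n}" "v c = v c'" "u c < u c'"
    and Z: "Z = {e \<in> line (u c). v c \<le> v e} \<union> {e \<in> line (u c'). v e \<le> v c}"
  shows "sym_op b {\<pi>. \<pi> permutes Z} (sym_op b (fib_group n u) (sym_op (\<not> b) (fib_group n v) f)) = 0"
proof -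
  let ?X = "{e \<in> line (u c). v c \<le> v e}" and ?Y = "{e \<in> line (u c'). v e \<le> v c}"
  let ?Q = "v ` line (u c)"
  have fin: "finite (line i)" for i
    by (simp add: line_def)
  have Zn: "Z \<subseteq> {1..n}"
    unfolding Z by (auto simp: line_def)
  have pgZ: "perm_group n {\<pi>. \<pi> permutes Z}"
    by (rule perm_group_permutes[OF Zn])
  have low: "j \<in> v ` ?Y" if j: "j \<le> v c" for j
  proof -
    obtain e where "e \<in> {1..n}" "u e = u c'" "v e = j"
      using coords_down[OF c(2) le_refl, of j] j c(3) by auto
    then show ?thesis
      using j by (intro image_eqI[of _ _ e]) (auto simp: line_def)
  qed
  have cZ: "card Z = card (v ` ?X) + card (v ` ?Y)"
  proof -
    have "card Z = card ?X + card ?Y"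
      unfolding Z using fin c(4) by (intro card_Un_disjoint) (auto simp: line_def)
    moreover have "inj_on v ?X" "inj_on v ?Y"
      by (rule inj_on_subset[OF inj_on_line], blast)+
    ultimately show ?thesis
      by (simp add: card_image)
  qed
  \<comment> \<open>Cross coordinates up to \<open>v c\<close> are covered by the second part of
    \<open>Z\<close>, those from \<open>v c\<close> onwards by the first.\<close>
  have "?Q \<subseteq> v ` ?X \<union> v ` ?Y"
    using low linear by blast
  then have "card ?Q \<le> card (v ` ?X \<union> v ` ?Y)"
    using fin by (intro card_mono) auto
  \<comment> \<open>The coordinate \<open>v c\<close> is covered twice; this overlap makes the
    inequality strict.\<close>
  moreover have "v c \<in> v ` ?X \<inter> v ` ?Y"
    using c(1) low[of "v c"] by (auto simp: line_def intro!: image_eqI[of _ v c])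
  then have "card (v ` ?X \<inter> v ` ?Y) > 0"
    using fin by (subst card_gt_0_iff) auto
  ultimately have lt: "card ?Q < card Z"
    unfolding cZ using card_Un_Int[of "v ` ?X" "v ` ?Y"] fin by simp
  have zero: "sym_op b {\<pi>. \<pi> permutes Z} (perm_act \<rho> (sym_op (\<not> b) (fib_group n v) f)) = 0"
    if \<rho>: "\<rho> \<in> fib_group n u" for \<rho>
  proof -
    have \<rho>i: "inv \<rho> \<in> fib_group n u" and \<rho>S: "\<rho> \<in> Sym n" "inv \<rho> \<in> Sym n"
      using \<rho> perm_groupD(1,4)[OF perm_group_fib] by blast+
    have sub: "(\<lambda>e. v (inv \<rho> e)) ` Z \<subseteq> ?Q"
    proof safe
      fix e assume e: "e \<in> Z"
      then have en: "e \<in> {1..n}" "inv \<rho> e \<in> {1..n}"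
        using Zn Sym_in[OF \<rho>S(2)] by auto
      then have "u (inv \<rho> e) = u e"
        using \<rho>i by (auto simp: fib_group_def)
      show "v (inv \<rho> e) \<in> ?Q"
      proof (cases "u e = u c")
        case True
        then show ?thesis
          using en \<open>u (inv \<rho> e) = u e\<close> by (auto simp: line_def)
      next
        case False
        then have "u e = u c'"
          using e unfolding Z line_def by blast
        \<comment> \<open>The line at \<open>u c\<close> is at least as long as the one at
          \<open>u c'\<close>, because \<open>u c < u c'\<close> and the diagram is closed
          downwards.\<close>
        then obtain e' where "e' \<in> {1..n}" "u e' = u c" "v e' = v (inv \<rho> e)"
          using coords_down[OF en(2), of "u c" "v (inv \<rho> e)"] c(4) \<open>u (inv \<rho> e) = u e\<close> by auto
        then show ?thesis
          by (intro image_eqI[of _ _ e']) (auto simp: line_def)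
      qed
    qed
    have "card ((\<lambda>e. v (inv \<rho> e)) ` Z) < card Z"
      using card_mono[OF _ sub] fin lt by (meson finite_imageI le_less_trans)
    then obtain x y where "x \<in> Z" "y \<in> Z" "x \<noteq> y" "v (inv \<rho> x) = v (inv \<rho> y)"
      using pigeonhole[of "\<lambda>e. v (inv \<rho> e)" Z] unfolding inj_on_def by blast
    then show ?thesis
      using Zn by (intro sym_op_vanish[OF two pgZ \<rho>S(1), of x y]) (auto intro: permutes_swap_id)
  qed
  show ?thesis
    unfolding sym_op_def[of b "fib_group n u"]
    by (simp add: sym_op_sum[OF perm_groupD(5)[OF pgZ]] sym_op_scale[OF perm_groupD(5)[OF pgZ]] zero)
qed

text \<open>All labels on \<open>X\<close> exceed those on \<open>Y\<close>. A permutation that does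
  not preserve \<open>X\<close> brings larger labels to \<open>Y\<close>, whose cells have the
  larger coefficient \<open>u c'\<close>, while the total over both sets stays the same.\<close>

lemma garnir_weight_less:
  assumes c: "c \<in> {1..n}" "c' \<in> {1..n}" "v c = v c'" "u c < u c'"
    and X: "X = {e \<in> line (u c). v c \<le> v e}" and Y: "Y = {e \<in> line (u c'). v e \<le> v c}"
    and h: "h permutes X \<union> Y" "h ` X \<noteq> X"
    and g: "inj g" and less: "\<And>x y. x \<in> X \<Longrightarrow> y \<in> Y \<Longrightarrow> g y < g x"
  shows "(\<Sum>e\<in>{1..n}. u e * g e) < (\<Sum>e\<in>{1..n}. u e * g (h e))"
proof -
  have fin: "finite X" "finite Y" and disj: "X \<inter> Y = {}"
    using c(4) by (auto simp: X Y line_def)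
  have Zn: "X \<union> Y \<subseteq> {1..n}"
    by (auto simp: X Y line_def)
  have hinj: "inj h"
    using permutes_inj[OF h(1)] .
  have hXY: "h ` X \<union> h ` Y = X \<union> Y" "h ` X \<inter> h ` Y = {}"
    using permutes_image[OF h(1)] disj image_Int[OF hinj, of X Y] by (auto simp: image_Un)
  have split: "(\<Sum>e\<in>{1..n}. u e * k e) =
      (\<Sum>e\<in>{1..n} - (X \<union> Y). u e * k e) + (u c * sum k X + u c' * sum k Y)" for k :: "nat \<Rightarrow> nat"
  proof -
    have "(\<Sum>e\<in>X \<union> Y. u e * k e) = u c * sum k X + u c' * sum k Y"
      using fin disj
      by (simp add: sum.union_disjoint sum_distrib_left)
         (auto simp: X Y line_def intro!: arg_cong2[where f="(+)"] sum.cong)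
    then show ?thesis
      using sum.subset_diff[OF Zn, of "\<lambda>e. u e * k e"] by simp
  qed
  have "sum g X + sum g Y = sum (\<lambda>e. g (h e)) X + sum (\<lambda>e. g (h e)) Y"
    using sum.permute[OF h(1), of g] fin disj by (simp add: sum.union_disjoint o_def)
  moreover have "sum g Y < sum (\<lambda>e. g (h e)) Y"
  proof -
    have "\<Sum>(g ` Y) < \<Sum>(g ` h ` Y)"
    proof (rule sum_less_exchange)
      show "card (g ` h ` Y) = card (g ` Y)"
        using g hinj by (simp add: card_image inj_on_subset[of _ UNIV])
      show "g ` h ` Y \<noteq> g ` Y"
      proof
        assume "g ` h ` Y = g ` Y"
        then have "h ` Y = Y"
          by (simp only: inj_image_eq_iff[OF g])
        then have "h ` X = X"
          using hXY disj by auto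
        then show False
          using h(2) by simp
      qed
      fix a b assume "a \<in> g ` h ` Y - g ` Y" "b \<in> g ` Y - g ` h ` Y"
      then have "a \<in> g ` X" "b \<in> g ` Y"
        using hXY(1) by blast+
      then show "b < a"
        using less by blast
    qed (use fin in auto)
    moreover have "\<Sum>(g ` Y) = sum g Y"
      using sum.reindex[of g Y "\<lambda>x. x"] g by (simp add: inj_on_subset[of _ UNIV])
    moreover have "\<Sum>(g ` h ` Y) = sum (\<lambda>e. g (h e)) Y"
      using sum.reindex[OF inj_on_subset[OF inj_compose[OF g hinj]], of Y "\<lambda>x. x"]
      by (simp add: image_image o_def)
    ultimately show ?thesis by simp
  qed
  moreover have "u e * g (h e) = u e * g e" if "e \<in> {1..n} - (X \<union> Y)" for e
    using that permutes_not_in[OF h(1), of e] by simp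
  then have "(\<Sum>e\<in>{1..n} - (X \<union> Y). u e * g (h e)) = (\<Sum>e\<in>{1..n} - (X \<union> Y). u e * g e)"
    by (intro sum.cong) auto
  \<comment> \<open>Moving a positive amount from the coefficient \<open>i\<close> to the larger
    \<open>i'\<close> raises the weighted sum.\<close>
  moreover have "i * a + i' * b < i * a' + i' * b'"
    if ab: "a + b = a' + b'" "b < b'" "i < i'" for i i' a b a' b' :: nat
  proof -
    obtain d where b': "b' = b + Suc d"
      using ab(2) less_iff_Suc_add by auto
    with ab(1) have a: "a = a' + Suc d" by simp
    have "i * Suc d < i' * Suc d"
      using ab(3) by (rule mult_less_mono1) simp
    then show ?thesis
      unfolding a b' by (simp add: algebra_simps)
  qed
  ultimately show ?thesis
    unfolding split using c(4) by simp
qed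

text \<open>Straightening by lexicographic induction on two weights. A swap inside a line keeps
  \<open>\<Phi>\<close> and raises \<open>\<Psi>\<close>; a Garnir relation expresses the translate
  through ones with larger \<open>\<Phi>\<close>. A labelling that admits neither move is
  standard.\<close>

theorem standard_span:
  fixes f :: "'k::field mpol"
  assumes fact: "(of_nat (fact n) :: 'k) \<noteq> 0" and two: "(2::'k) \<noteq> 0"
    and W: "W = sym_op b (fib_group n u) (sym_op (\<not> b) (fib_group n v) f)"
    and g: "g \<in> Sym n"
  shows "perm_act g W \<in> mpol.span {perm_act g' W | g'. g' \<in> Sym n \<and> std_labelling n u v g'}"
    (is "_ \<in> ?V")
proof -
  define \<Phi> where "\<Phi> g = (\<Sum>e\<in>{1..n}. u e * g e)" for g
  define \<Psi> where "\<Psi> g = (\<Sum>e\<in>{1..n}. v e * g e)" for g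
  \<comment> \<open>The weights grow during straightening; subtracting them from upper bounds, valid
    as labels are at most \<open>n\<close>, gives a well-founded measure.\<close>
  define BU where "BU = (\<Sum>e\<in>{1..n}. u e * n)"
  define BV where "BV = (\<Sum>e\<in>{1..n}. v e * n)"
  have BU: "\<Phi> g \<le> BU" and BV: "\<Psi> g \<le> BV" if g: "g \<in> Sym n" for g
  proof -
    have "g e \<le> n" if "e \<in> {1..n}" for e
      using Sym_in[OF g, of e] that by simp
    then show "\<Phi> g \<le> BU" "\<Psi> g \<le> BV"
      unfolding \<Phi>_def \<Psi>_def BU_def BV_def by (intro sum_mono mult_le_mono2; simp)+
  qed
  have "wf (measures [\<lambda>g. BU - \<Phi> g, \<lambda>g. BV - \<Psi> g])"
    by simp
  then show ?thesis
    using g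
  proof (induction g rule: wf_induct_rule)
    case (less g)
    note g = less.prems
    have IH: "perm_act g' W \<in> ?V"
      if "g' \<in> Sym n" "\<Phi> g < \<Phi> g' \<or> \<Phi> g = \<Phi> g' \<and> \<Psi> g < \<Psi> g'" for g'
      using that BU[OF that(1)] BV[OF that(1)] by (intro less.IH) auto
    have inj: "inj g"
      using Sym_bij[OF g] by (rule bij_is_inj)
    show ?case
    proof (cases "\<exists>c\<in>{1..n}. \<exists>c'\<in>{1..n}. u c = u c' \<and> v c < v c' \<and> g c' < g c")
      case True
      then obtain c c' where c: "c \<in> {1..n}" "c' \<in> {1..n}" "u c = u c'" "v c < v c'" "g c' < g c"
        by blast
      let ?t = "transpose c c'"
      \<comment> \<open>\<open>W\<close> absorbs this transposition up to a sign, so the translates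
        by \<open>g\<close> and by \<open>g \<circ> ?t\<close> span the same line.\<close>
      have t: "?t \<in> fib_group n u" "?t \<in> Sym n"
        using c by (auto intro: transpose_fib transpose_Sym)
      have "\<Phi> (g \<circ> ?t) = (\<Sum>e\<in>{1..n}. u (?t e) * g (?t e))"
        unfolding \<Phi>_def using t(1) by (intro sum.cong) (auto simp: fib_group_def)
      also have "\<dots> = \<Phi> g"
        unfolding \<Phi>_def using sum.permute[OF Sym_permutes[OF t(2)], of "\<lambda>e. u e * g e"]
        by (simp add: o_def)
      finally have "\<Phi> (g \<circ> ?t) = \<Phi> g" .
      moreover have "\<Psi> g < \<Psi> (g \<circ> ?t)"
        unfolding \<Psi>_def using sum_less_transpose[of "{1..n}" c c' v g] c by simp
      ultimately have "perm_act (g \<circ> ?t) W \<in> ?V"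
        using g t(2) by (intro IH) (auto simp: Sym_comp)
      moreover have "perm_act (g \<circ> ?t) W = poly_scale (ch b ?t) (perm_act g W)"
        using Sym_bij[OF g] Sym_bij[OF t(2)]
        by (simp add: W perm_act_scale sym_op_absorb_left[OF perm_group_fib t(1)] flip: perm_act_comp)
      then have "perm_act g W = poly_scale (ch b ?t) (perm_act (g \<circ> ?t) W)"
        by simp
      ultimately show ?thesis
        by (simp only: mpol.span_scale)
    next
      case no: False
      show ?thesis
      proof (cases "\<exists>c\<in>{1..n}. \<exists>c'\<in>{1..n}. v c = v c' \<and> u c < u c' \<and> g c' < g c")
        case True
        then obtain c c' where c: "c \<in> {1..n}" "c' \<in> {1..n}" "v c = v c'" "u c < u c'"
          and gc: "g c' < g c"
          by blast
        define X where "X = {e \<in> line (u c). v c \<le> v e}"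
        define Y where "Y = {e \<in> line (u c'). v e \<le> v c}"
        define S where "S = {\<pi>. \<pi> permutes X \<union> Y}"
        \<comment> \<open>The elements of \<open>K\<close> permute \<open>X\<close> and
          \<open>Y\<close> separately, hence within lines, and are absorbed by \<open>W\<close>.
          Their terms in the Garnir relation add up to a multiple of the translate by
          \<open>g\<close>; the other terms have larger \<open>\<Phi>\<close>.\<close>
        define K where "K = {\<pi> \<in> S. \<pi> ` X = X}"
        have Zn: "X \<union> Y \<subseteq> {1..n}" and disj: "X \<inter> Y = {}"
          using c(4) by (auto simp: X_def Y_def line_def)
        have S: "perm_group n S"
          unfolding S_def by (rule perm_group_permutes[OF Zn])
        note SD = perm_groupD[OF S]
        have K: "perm_group n K"
        proof -
          have "inv \<pi> ` X = X" if "\<pi> \<in> S" "\<pi> ` X = X" for \<pi>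
            using that(2) bij_is_inj[OF Sym_bij[OF SD(1)[OF that(1)]]] by (metis image_inv_f_f)
          moreover have "(\<pi> \<circ> \<rho>) ` X = X" if "\<pi> ` X = X" "\<rho> ` X = X" for \<pi> \<rho> :: "nat \<Rightarrow> nat"
            using that by (metis image_comp)
          ultimately show ?thesis
            unfolding perm_group_def K_def using SD(1-4)
            by (intro conjI subsetI ballI) simp_all
        qed
        \<comment> \<open>As no line has an inversion, \<open>c\<close> carries the least label of
          \<open>X\<close> and \<open>c'\<close> the greatest of \<open>Y\<close>; the inversion
          between \<open>c\<close> and \<open>c'\<close> then separates all labels of
          \<open>X\<close> from those of \<open>Y\<close>.\<close>
        have mono: "g e \<le> g e'" if "e \<in> {1..n}" "e' \<in> {1..n}" "u e = u e'" "v e < v e'" for e e'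
          using no that not_less by blast
        have less: "g y < g x" if "x \<in> X" "y \<in> Y" for x y
        proof -
          have "g c \<le> g x"
            using that(1) mono[of c x] c(1) coords_inj[of c x] unfolding X_def line_def
            by (cases "v c = v x") auto
          moreover have "g y \<le> g c'"
            using that(2) mono[of y c'] c coords_inj[of c' y] unfolding Y_def line_def
            by (cases "v c' = v y") auto
          ultimately show ?thesis
            using gc by simp
        qed
        have Kact: "poly_scale (ch b h) (perm_act h W) = W" if h: "h \<in> K" for h
        proof -
          have hp: "h permutes X \<union> Y" "h ` X = X"
            using h by (auto simp: K_def S_def)
          have "X \<union> h ` Y = X \<union> Y"
            using permutes_image[OF hp(1)] hp(2) by (simp add: image_Un)
          moreover have "X \<inter> h ` Y = {}"
            using image_Int[OF permutes_inj[OF hp(1)], of X Y] hp(2) disj by simp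
          ultimately have "h ` Y = Y"
            using disj by blast
          have "u (h e) = u e" for e
          proof (cases "e \<in> X \<union> Y")
            case True
            then have "(e \<in> X \<and> h e \<in> X) \<or> (e \<in> Y \<and> h e \<in> Y)"
              using hp(2) \<open>h ` Y = Y\<close> by blast
            then show ?thesis
              by (auto simp: X_def Y_def line_def)
          next
            case False
            then show ?thesis
              using permutes_not_in[OF hp(1)] by simp
          qed
          then have "h \<in> fib_group n u"
            using perm_groupD(1)[OF K h] by (simp add: fib_group_def)
          then show ?thesis
            unfolding W by (simp add: sym_op_absorb_left[OF perm_group_fib])
        qed
        let ?F = "\<lambda>h. poly_scale (ch b h) (perm_act (g \<circ> h) W)"
        have move: "perm_act g (poly_scale (ch b h) (perm_act h W)) = ?F h" if "h \<in> S" for h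
          using Sym_bij[OF g] Sym_bij[OF SD(1)[OF that]] by (simp add: perm_act_scale perm_act_comp)
        \<comment> \<open>The Garnir relation translated by \<open>g\<close>, to be solved for the
          part coming from \<open>K\<close>.\<close>
        have "0 = perm_act g (sym_op b S W)"
          unfolding S_def W using garnir_zero[OF two c, of "X \<union> Y"] by (simp add: X_def Y_def)
        also have "\<dots> = (\<Sum>h\<in>S. ?F h)"
          unfolding sym_op_def perm_act_sum[OF Sym_bij[OF g]] by (intro sum.cong refl move)
        also have "\<dots> = (\<Sum>h\<in>S - K. ?F h) + (\<Sum>h\<in>K. ?F h)"
          using SD(6) by (intro sum.subset_diff) (auto simp: K_def)
        also have "(\<Sum>h\<in>K. ?F h) = (\<Sum>h\<in>K. perm_act g W)"
        proof (intro sum.cong refl)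
          fix h assume h: "h \<in> K"
          show "?F h = perm_act g W"
            using move[of h] Kact[OF h] h by (simp add: K_def)
        qed
        also have "\<dots> = poly_scale (of_nat (card K)) (perm_act g W)"
          by (rule sum_poly_scale_const)
        finally have "0 = (\<Sum>h\<in>S - K. ?F h) + poly_scale (of_nat (card K)) (perm_act g W)" .
        then have "poly_scale (of_nat (card K)) (perm_act g W) = - (\<Sum>h\<in>S - K. ?F h)"
          by (simp add: eq_neg_iff_add_eq_0 add.commute)
        moreover have "(\<Sum>h\<in>S - K. ?F h) \<in> ?V"
        proof (intro mpol.span_sum mpol.span_scale IH)
          fix h assume h: "h \<in> S - K"
          then show "g \<circ> h \<in> Sym n"
            using SD(1) by (intro Sym_comp[OF g]) auto
          have "\<Phi> g < \<Phi> (g \<circ> h)"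
            unfolding \<Phi>_def o_def
          proof (rule garnir_weight_less[OF c X_def Y_def _ _ inj])
            show "h permutes X \<union> Y" "h ` X \<noteq> X"
              using h by (auto simp: S_def K_def)
          qed (rule less)
          then show "\<Phi> g < \<Phi> (g \<circ> h) \<or> \<Phi> g = \<Phi> (g \<circ> h) \<and> \<Psi> g < \<Psi> (g \<circ> h)"
            by blast
        qed
        ultimately have "poly_scale (of_nat (card K)) (perm_act g W) \<in> ?V"
          by (simp only: mpol.span_neg)
        then have "poly_scale (inverse (of_nat (card K)))
            (poly_scale (of_nat (card K)) (perm_act g W)) \<in> ?V"
          by (rule mpol.span_scale)
        moreover have "(of_nat (card K) :: 'k) \<noteq> 0"
          using card_perm_group_dvd[OF K] fact by (metis dvdE mult_zero_left of_nat_mult)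
        ultimately show ?thesis
          by simp
      next
        case False
        have "std_labelling n u v g"
          unfolding std_labelling_def
          using no False inj_eq[OF inj] by (metis linorder_neqE_nat less_irrefl)
        then show ?thesis
          using g by (intro mpol.span_base) blast
      qed
    qed
  qed
qed

end


section \<open>Cyclic submodules\<close>

lemma ga_act_add_left: "ga_act n (\<lambda>\<pi>. a \<pi> + b \<pi>) (f :: 'k::field mpol) = ga_act n a f + ga_act n b f"
  by (simp add: ga_act_def mpol.scale_left_distrib sum.distrib)

lemma ga_act_diff_left: "ga_act n (\<lambda>\<pi>. a \<pi> - b \<pi>) (f :: 'k::field mpol) = ga_act n a f - ga_act n b f"
  by (simp add: ga_act_def mpol.scale_left_diff_distrib sum_subtractf)

lemma ga_act_scale_left: "ga_act n (ga_scale s a) (f :: 'k::field mpol) = poly_scale s (ga_act n a f)"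
  by (simp add: ga_act_def ga_scale_def mpol.scale_sum_right)

lemma ga_act_scale_right:
  "ga_act n a (poly_scale s f) = poly_scale s (ga_act n a (f :: 'k::field mpol))"
  unfolding ga_act_def mpol.scale_sum_right
  by (intro sum.cong) (simp_all add: Sym_bij perm_act_scale mult.commute)

lemma ga_act_zero_right [simp]: "ga_act n a (0 :: 'k::field mpol) = 0"
  by (simp add: ga_act_def)

lemma ga_act_in_poly_ring:
  "f \<in> poly_ring n \<Longrightarrow> ga_act n a (f :: 'k::field mpol) \<in> poly_ring n"
  unfolding ga_act_def
  by (intro mpol.subspace_sum[OF subspace_poly_ring] mpol.subspace_scale[OF subspace_poly_ring]
      poly_ring_perm_act)

lemma ga_act_mult: "ga_act n (ga_mult n a b) (f :: 'k::field mpol) = ga_act n a (ga_act n b f)"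
proof -
  have "ga_act n (ga_mult n a b) f =
      (\<Sum>\<tau>\<in>Sym n. \<Sum>\<pi>\<in>Sym n. \<Sum>\<rho>\<in>Sym n.
         if \<pi> \<circ> \<rho> = \<tau> then poly_scale (a \<pi> * b \<rho>) (perm_act \<tau> f) else 0)"
    unfolding ga_act_def ga_mult_def mpol.scale_sum_left by (intro sum.cong refl) simp
  also have "\<dots> = (\<Sum>\<pi>\<in>Sym n. \<Sum>\<rho>\<in>Sym n. \<Sum>\<tau>\<in>Sym n.
         if \<pi> \<circ> \<rho> = \<tau> then poly_scale (a \<pi> * b \<rho>) (perm_act \<tau> f) else 0)"
    by (subst sum.swap, rule sum.cong[OF refl], rule sum.swap)
  also have "\<dots> = (\<Sum>\<pi>\<in>Sym n. \<Sum>\<rho>\<in>Sym n. poly_scale (a \<pi> * b \<rho>) (perm_act (\<pi> \<circ> \<rho>) f))"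
    by (intro sum.cong refl) (simp add: Sym_comp)
  also have "\<dots> = ga_act n a (ga_act n b f)"
    unfolding ga_act_def
    by (intro sum.cong refl)
       (simp add: perm_act_sum Sym_bij mpol.scale_sum_right perm_act_scale perm_act_comp)
  finally show ?thesis .
qed

lemma perm_act_eq_ga_act:
  assumes "g \<in> Sym n"
  shows "perm_act g f = ga_act n (\<lambda>\<pi>. if \<pi> = g then 1 else 0) (f :: 'k::field mpol)"
proof -
  have "ga_act n (\<lambda>\<pi>. if \<pi> = g then 1 else 0) f = (\<Sum>\<pi>\<in>Sym n. if \<pi> = g then perm_act \<pi> f else 0)"
    unfolding ga_act_def by (intro sum.cong) auto
  then show ?thesis
    using assms by simp
qed

definition sym_elem :: "bool \<Rightarrow> (nat \<Rightarrow> nat) set \<Rightarrow> 'k::comm_ring_1 grp_alg" where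
  "sym_elem b H = (\<lambda>\<pi>. if \<pi> \<in> H then ch b \<pi> else 0)"

lemma sym_op_eq_ga_act:
  assumes "H \<subseteq> Sym n"
  shows "sym_op b H f = ga_act n (sym_elem b H) f"
  unfolding sym_op_def ga_act_def sym_elem_def
  using assms by (intro sum.mono_neutral_cong_left) auto

definition cyc :: "nat \<Rightarrow> 'k::field mpol \<Rightarrow> 'k mpol set" where
  "cyc n z = range (\<lambda>a. ga_act n a z)"

definition invariant_subspace :: "nat \<Rightarrow> 'k::field mpol set \<Rightarrow> bool" where
  "invariant_subspace n U \<longleftrightarrow> mpol.subspace U \<and> (\<forall>\<pi>\<in>Sym n. \<forall>f\<in>U. perm_act \<pi> f \<in> U)"

lemma invariant_ga_act: "invariant_subspace n U \<Longrightarrow> f \<in> U \<Longrightarrow> ga_act n a f \<in> U"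
  unfolding invariant_subspace_def ga_act_def
  by (intro mpol.subspace_sum mpol.subspace_scale) auto

lemma ga_act_in_cyc [simp]: "ga_act n a z \<in> cyc n z"
  by (simp add: cyc_def)

lemma gen_in_cyc: "z \<in> cyc n z"
  using perm_act_eq_ga_act[OF Sym_id, where n=n and f=z] by (metis perm_act_id ga_act_in_cyc)

lemma invariant_cyc: "invariant_subspace n (cyc n z)"
  unfolding invariant_subspace_def cyc_def
proof (intro conjI mpol.subspaceI ballI)
  have "ga_act n (\<lambda>_. 0) z = 0"
    by (simp add: ga_act_def)
  then show "0 \<in> range (\<lambda>a. ga_act n a z)"
    by (metis rangeI)
qed (auto simp: perm_act_eq_ga_act simp flip: ga_act_add_left ga_act_scale_left ga_act_mult)

lemma cyc_subset: "invariant_subspace n U \<Longrightarrow> z \<in> U \<Longrightarrow> cyc n z \<subseteq> U"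
  unfolding cyc_def using invariant_ga_act by blast

lemma cyc_eq_span: "cyc n z = mpol.span {perm_act g z | g. g \<in> Sym n}"
proof
  show "cyc n z \<subseteq> mpol.span {perm_act g z | g. g \<in> Sym n}"
    unfolding cyc_def ga_act_def
    by (auto intro!: mpol.span_sum mpol.span_scale intro: mpol.span_base)
  show "mpol.span {perm_act g z | g. g \<in> Sym n} \<subseteq> cyc n z"
    using invariant_cyc[of n z] gen_in_cyc[of z n]
    by (intro mpol.span_minimal) (auto simp: invariant_subspace_def)
qed

lemma subrep_cyc:
  assumes "z \<in> poly_ring n"
  shows "subrep n (cyc n z)"
  using invariant_cyc[of n z] ga_act_in_poly_ring[OF assms]
  unfolding subrep_def invariant_subspace_def cyc_def by blast

lemma cyc_scale: "cyc n (poly_scale s z) = poly_scale s ` cyc n z"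
  unfolding cyc_def by (simp add: ga_act_scale_right image_image)

text \<open>Equal annihilators make the map from \<open>a z\<close> to \<open>a z'\<close> well
  defined and injective, whichever \<open>a\<close> is chosen to represent an element.\<close>

lemma rep_isomorphic_cyc:
  fixes z z' :: "'k::field mpol"
  assumes z: "z \<in> poly_ring n" "z' \<in> poly_ring n"
    and ann: "\<And>a. ga_act n a z = 0 \<longleftrightarrow> ga_act n a z' = 0"
  shows "rep_isomorphic n (cyc n z) (cyc n z')"
proof -
  have eq_iff: "ga_act n a z = ga_act n b z \<longleftrightarrow> ga_act n a z' = ga_act n b z'" for a b
    using ann[of "\<lambda>\<pi>. a \<pi> - b \<pi>"] by (simp add: ga_act_diff_left)
  define \<phi> where "\<phi> f = ga_act n (SOME a. f = ga_act n a z) z'" for f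
  have \<phi>: "\<phi> (ga_act n a z) = ga_act n a z'" for a
  proof -
    have "ga_act n a z = ga_act n (SOME b. ga_act n a z = ga_act n b z) z"
      by (rule someI[of "\<lambda>b. ga_act n a z = ga_act n b z", OF refl])
    then show ?thesis
      unfolding \<phi>_def using eq_iff by metis
  qed
  have "bij_betw \<phi> (cyc n z) (cyc n z')"
    unfolding bij_betw_def inj_on_def cyc_def using eq_iff by (auto simp: \<phi> image_image)
  moreover have "\<phi> (f + g) = \<phi> f + \<phi> g" if "f \<in> cyc n z" "g \<in> cyc n z" for f g
    using that unfolding cyc_def by (auto simp: \<phi> simp flip: ga_act_add_left)
  moreover have "\<phi> (poly_scale a f) = poly_scale a (\<phi> f)" if "f \<in> cyc n z" for a f
    using that unfolding cyc_def by (auto simp: \<phi> simp flip: ga_act_scale_left)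
  moreover have "\<phi> (perm_act \<pi> f) = perm_act \<pi> (\<phi> f)" if "\<pi> \<in> Sym n" "f \<in> cyc n z" for \<pi> f
    using that unfolding cyc_def
    by (auto simp: \<phi> perm_act_eq_ga_act simp flip: ga_act_mult)
  ultimately show ?thesis
    unfolding rep_isomorphic_def using subrep_cyc[OF z(1)] subrep_cyc[OF z(2)] by blast
qed

section \<open>Equivariant projections\<close>

text \<open>Required on all polynomials, so that a projection onto a submodule can also be applied
  to a generator outside it.\<close>

definition equivariant :: "nat \<Rightarrow> ('k::field mpol \<Rightarrow> 'k mpol) \<Rightarrow> bool" where
  "equivariant n q \<longleftrightarrow> (\<forall>f g. q (f + g) = q f + q g) \<and>
     (\<forall>a f. q (poly_scale a f) = poly_scale a (q f)) \<and>
     (\<forall>\<pi>\<in>Sym n. \<forall>f. q (perm_act \<pi> f) = perm_act \<pi> (q f))"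

lemma equivariant_ga_act:
  assumes "equivariant n q"
  shows "q (ga_act n a f) = ga_act n a (q f)"
proof -
  have add: "q (f + g) = q f + q g" for f g
    using assms by (simp add: equivariant_def)
  have "q (poly_scale 0 0) = poly_scale 0 (q 0)"
    using assms unfolding equivariant_def by blast
  then have "q 0 = 0"
    by simp
  then have "q (\<Sum>i\<in>A. h i) = (\<Sum>i\<in>A. q (h i))" for A and h :: "(nat \<Rightarrow> nat) \<Rightarrow> _"
    by (induction A rule: infinite_finite_induct) (simp_all add: add)
  then show ?thesis
    unfolding ga_act_def using assms by (simp add: equivariant_def)
qed

lemma equivariant_sym_op:
  "equivariant n q \<Longrightarrow> H \<subseteq> Sym n \<Longrightarrow> q (sym_op b H f) = sym_op b H (q f)"
  by (simp add: sym_op_eq_ga_act equivariant_ga_act)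

interpretation mpol_pair:
  vector_space_pair "poly_scale :: 'k::field \<Rightarrow> 'k mpol \<Rightarrow> 'k mpol" "poly_scale :: 'k \<Rightarrow> 'k mpol \<Rightarrow> 'k mpol" ..

text \<open>A linear projection onto \<open>U\<close>, averaged over its conjugates, becomes
  equivariant; the division by n! is where the characteristic enters.\<close>

lemma maschke:
  fixes U :: "'k::field mpol set"
  assumes fact: "(of_nat (fact n) :: 'k) \<noteq> 0" and U: "invariant_subspace n U"
  obtains q where "equivariant n q" "\<And>f. q f \<in> U" "\<And>f. f \<in> U \<Longrightarrow> q f = f"
proof -
  have sub: "mpol.subspace U" and inv: "\<And>\<pi> f. \<pi> \<in> Sym n \<Longrightarrow> f \<in> U \<Longrightarrow> perm_act \<pi> f \<in> U"
    using U by (auto simp: invariant_subspace_def)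
  \<comment> \<open>A left inverse on \<open>U\<close> of the identity map, with range in
    \<open>U\<close>, is a linear projection onto \<open>U\<close>.\<close>
  obtain p where p: "range p \<subseteq> U" "Vector_Spaces.linear poly_scale poly_scale p" "\<And>f. f \<in> U \<Longrightarrow> p f = f"
    using mpol_pair.linear_exists_left_inverse_on[OF mpol.linear_ident sub] by auto
  interpret p: Vector_Spaces.linear poly_scale poly_scale p
    by (fact p(2))
  have p_add: "p (f + g) = p f + p g" and p_scale: "p (poly_scale a f) = poly_scale a (p f)" for f g a
    by (simp_all add: p.add p.scale)
  define q where "q f = poly_scale (inverse (of_nat (fact n)))
    (\<Sum>\<pi>\<in>Sym n. perm_act (inv \<pi>) (p (perm_act \<pi> f)))" for f
  have "q (perm_act \<rho> f) = perm_act \<rho> (q f)" if \<rho>: "\<rho> \<in> Sym n" for \<rho> f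
  proof -
    have "perm_act \<rho> (\<Sum>\<pi>\<in>Sym n. perm_act (inv \<pi>) (p (perm_act \<pi> f))) =
        perm_act \<rho> (\<Sum>\<pi>\<in>Sym n. perm_act (inv (\<pi> \<circ> \<rho>)) (p (perm_act (\<pi> \<circ> \<rho>) f)))"
      by (subst sum.reindex_bij_betw[OF bij_betw_comp_right[OF perm_group_Sym \<rho>], symmetric]) simp
    also have "\<dots> = (\<Sum>\<pi>\<in>Sym n. perm_act (inv \<pi>) (p (perm_act \<pi> (perm_act \<rho> f))))"
      unfolding perm_act_sum[OF Sym_bij[OF \<rho>]]
    proof (intro sum.cong refl)
      fix \<pi> assume \<pi>: "\<pi> \<in> Sym n"
      have "\<rho> \<circ> inv (\<pi> \<circ> \<rho>) = inv \<pi>"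
        using Sym_inv_comp[OF \<pi> \<rho>] Sym_bij[OF \<rho>] by simp
      then show "perm_act \<rho> (perm_act (inv (\<pi> \<circ> \<rho>)) (p (perm_act (\<pi> \<circ> \<rho>) f))) =
          perm_act (inv \<pi>) (p (perm_act \<pi> (perm_act \<rho> f)))"
        using Sym_bij[OF \<rho>] Sym_bij[OF \<pi>] by (simp add: perm_act_comp bij_comp)
    qed
    finally show ?thesis
      unfolding q_def using Sym_bij[OF \<rho>] by (simp add: perm_act_scale)
  qed
  then have "equivariant n q"
    unfolding equivariant_def q_def
    by (auto simp: perm_act_add perm_act_scale Sym_bij p_add p_scale sum.distrib mpol.scale_right_distrib
        mpol.scale_sum_right mult.commute)
  moreover have "q f \<in> U" for f
    unfolding q_def using p(1)
    by (intro mpol.subspace_scale[OF sub] mpol.subspace_sum[OF sub] inv Sym_inv) auto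
  moreover have "q f = f" if f: "f \<in> U" for f
  proof -
    have "perm_act (inv \<pi>) (p (perm_act \<pi> f)) = f" if "\<pi> \<in> Sym n" for \<pi>
      using p(3)[OF inv[OF that f]] Sym_bij[OF that] by (simp add: perm_act_comp)
    then have "(\<Sum>\<pi>\<in>Sym n. perm_act (inv \<pi>) (p (perm_act \<pi> f))) = poly_scale (of_nat (fact n)) f"
      using sum_poly_scale_const[of f "Sym n"] by (simp del: sum_constant add: card_Sym)
    then show ?thesis
      unfolding q_def using fact by simp
  qed
  ultimately show ?thesis
    using that by blast
qed

lemma equivariant_vanish_cyc:
  assumes "equivariant n q" "q z = 0" "f \<in> cyc n z"
  shows "q f = 0"
  using assms by (auto simp: cyc_def equivariant_ga_act)

text \<open>An equivariant projection \<open>q\<close> onto \<open>U\<close> passes through both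
  operators, and the inner one kills \<open>q x\<close> since it lies in \<open>U\<close>. So
  \<open>q\<close> kills the generator and hence \<open>U\<close>, on which it is the
  identity.\<close>

lemma trivial_if_sym_op_vanish_inner:
  fixes U :: "'k::field mpol set"
  assumes fact: "(of_nat (fact n) :: 'k) \<noteq> 0" and U: "invariant_subspace n U"
    and sub: "U \<subseteq> cyc n (sym_op b' H' (sym_op b H x))" and H: "H \<subseteq> Sym n" "H' \<subseteq> Sym n"
    and zero: "\<And>f. f \<in> U \<Longrightarrow> sym_op b H f = 0"
    and f: "f \<in> U"
  shows "f = 0"
proof -
  obtain q where q: "equivariant n q" "\<And>f. q f \<in> U" "\<And>f. f \<in> U \<Longrightarrow> q f = f"
    by (rule maschke[OF fact U]) (rule that)
  have "q (sym_op b' H' (sym_op b H x)) = 0"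
    by (simp add: equivariant_sym_op[OF q(1)] H zero q(2))
  then show ?thesis
    using equivariant_vanish_cyc[OF q(1)] f sub q(3) by (metis subsetD)
qed

text \<open>Here the vanishing operator is the outermost one of the generator. It is idempotent up
  to the invertible order of \<open>H\<close>, so it can be applied once more and pulled through the
  projection.\<close>

lemma trivial_if_sym_op_vanish_outer:
  fixes U :: "'k::field mpol set"
  assumes fact: "(of_nat (fact n) :: 'k) \<noteq> 0" and U: "invariant_subspace n U"
    and sub: "U \<subseteq> cyc n (sym_op b H x)" and H: "perm_group n H"
    and zero: "\<And>f. f \<in> U \<Longrightarrow> sym_op b H f = 0"
    and f: "f \<in> U"
  shows "f = 0"
proof -
  obtain q where q: "equivariant n q" "\<And>f. q f \<in> U" "\<And>f. f \<in> U \<Longrightarrow> q f = f"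
    by (rule maschke[OF fact U]) (rule that)
  have "(of_nat (card H) :: 'k) \<noteq> 0"
    using card_perm_group_dvd[OF H] fact by (metis dvdE mult_zero_left of_nat_mult)
  moreover have "poly_scale (of_nat (card H)) (q (sym_op b H x)) = sym_op b H (q (sym_op b H x))"
    using q(1) by (simp add: equivariant_sym_op[OF q(1) perm_groupD(5)[OF H]] sym_op_idem[OF H])
  ultimately have "q (sym_op b H x) = 0"
    using zero[OF q(2)] by (simp add: mpol.scale_eq_0_iff)
  then show ?thesis
    using equivariant_vanish_cyc[OF q(1)] f sub q(3) by (metis subsetD)
qed

section \<open>The two Young symmetrizers generate isomorphic modules\<close>

context young_coords
begin

text \<open>Linear extension from permutations to the group algebra; the scalar stays uniform in
  \<open>f\<close>.\<close>

lemma sandwich_ga_act: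
  assumes two: "(2::'k::field) \<noteq> 0"
  obtains k :: "'k::field" where "\<And>f. sym_op b (fib_group n u) (ga_act n a (sym_op (\<not> b) (fib_group n v) f)) =
    poly_scale k (sym_op b (fib_group n u) (sym_op (\<not> b) (fib_group n v) f))"
proof -
  let ?C = "sym_op b (fib_group n u) :: 'k mpol \<Rightarrow> _" and ?R = "sym_op (\<not> b) (fib_group n v) :: 'k mpol \<Rightarrow> _"
  have "\<forall>g\<in>Sym n. \<exists>k. \<forall>f. ?C (perm_act g (?R f)) = poly_scale k (?C (?R f))"
    using sandwich[OF two] by (intro ballI)
  from bchoice[OF this] obtain K where
    K: "\<forall>g\<in>Sym n. \<forall>f. ?C (perm_act g (?R f)) = poly_scale (K g) (?C (?R f))" ..
  show ?thesis
  proof (rule that[of "\<Sum>g\<in>Sym n. a g * K g"])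
    fix f
    show "sym_op b (fib_group n u) (ga_act n a (sym_op (\<not> b) (fib_group n v) f)) =
      poly_scale (\<Sum>g\<in>Sym n. a g * K g) (sym_op b (fib_group n u) (sym_op (\<not> b) (fib_group n v) f))"
      unfolding ga_act_def sym_op_sum[OF perm_groupD(5)[OF perm_group_fib]] mpol.scale_sum_left
      by (intro sum.cong refl) (simp add: sym_op_scale[OF perm_groupD(5)[OF perm_group_fib]] K)
  qed
qed

text \<open>The link is \<open>c r c x\<close>: it has the annihilator of \<open>c r x\<close> and
  generates the same module as \<open>r c x\<close>.\<close>

theorem rep_isomorphic_symmetrizers:
  fixes x :: "'k::field mpol"
  assumes fact: "(of_nat (fact n) :: 'k) \<noteq> 0" and two: "(2::'k) \<noteq> 0" and x: "x \<in> poly_ring n"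
    and cr: "sym_op b (fib_group n u) (sym_op (\<not> b) (fib_group n v) x) \<noteq> 0"
    and rc: "sym_op (\<not> b) (fib_group n v) (sym_op b (fib_group n u) x) \<noteq> 0"
  shows "rep_isomorphic n
    (cyc n (poly_scale s (sym_op b (fib_group n u) (sym_op (\<not> b) (fib_group n v) x))))
    (cyc n (poly_scale s (sym_op (\<not> b) (fib_group n v) (sym_op b (fib_group n u) x))))"
proof -
  define c where "c = (sym_op b (fib_group n u) :: 'k mpol \<Rightarrow> _)"
  define r where "r = (sym_op (\<not> b) (fib_group n v) :: 'k mpol \<Rightarrow> _)"
  define ce where "ce = (sym_elem b (fib_group n u) :: 'k grp_alg)"
  define re where "re = (sym_elem (\<not> b) (fib_group n v) :: 'k grp_alg)"
  note fib = perm_group_fib perm_groupD(5)[OF perm_group_fib]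
  have c_ga: "c f = ga_act n ce f" and r_ga: "r f = ga_act n re f" for f
    by (simp_all add: c_def ce_def r_def re_def sym_op_eq_ga_act fib)
  have nz: "c (r x) \<noteq> 0" "r (c x) \<noteq> 0"
    using cr rc by (simp_all add: c_def r_def)
  have sand: "\<exists>k. \<forall>f. c (ga_act n a (r f)) = poly_scale k (c (r f))"
    "\<exists>k. \<forall>f. r (ga_act n a (c f)) = poly_scale k (r (c f))" for a
    using sandwich_ga_act[OF two, of b a] young_coords.sandwich_ga_act[OF swap two, of "\<not> b" a]
    unfolding c_def r_def not_not by metis+
  have inner: "f = 0"
    if "invariant_subspace n U" "U \<subseteq> cyc n (r (c x))" "\<And>f. f \<in> U \<Longrightarrow> c f = 0" "f \<in> U" for U f
    using trivial_if_sym_op_vanish_inner[OF fact that(1)] that(2-) fib(2) unfolding c_def r_def by blast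
  have outer_c: "f = 0"
    if "invariant_subspace n U" "U \<subseteq> cyc n (c (r x))" "\<And>f. f \<in> U \<Longrightarrow> c f = 0" "f \<in> U" for U f
    using trivial_if_sym_op_vanish_outer[OF fact that(1)] that(2-) fib(1) unfolding c_def by blast
  have outer_r: "f = 0"
    if "invariant_subspace n U" "U \<subseteq> cyc n (r (c x))" "\<And>f. f \<in> U \<Longrightarrow> r f = 0" "f \<in> U" for U f
    using trivial_if_sym_op_vanish_outer[OF fact that(1)] that(2-) fib(1) unfolding r_def by blast
  have crc_in: "c (r (c x)) \<in> cyc n (r (c x))"
    by (simp add: c_ga)
  \<comment> \<open>If it were zero, the sandwich identity would let \<open>c\<close> kill the whole
    module of \<open>r c x\<close>, which is then zero.\<close>
  have crc_nz: "c (r (c x)) \<noteq> 0"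
  proof
    assume *: "c (r (c x)) = 0"
    have "c f = 0" if f: "f \<in> cyc n (r (c x))" for f
    proof -
      obtain a where a: "f = ga_act n a (r (c x))"
        using f by (auto simp: cyc_def)
      obtain k where "c f = poly_scale k (c (r (c x)))"
        unfolding a using sand(1)[of a] by blast
      then show ?thesis
        using * by simp
    qed
    then have "r (c x) = 0"
      by (intro inner[OF invariant_cyc order_refl _ gen_in_cyc])
    then show False
      using nz by simp
  qed
  \<comment> \<open>Von Neumann's lemma for the middle element \<open>a' a c\<close>, which sits
    between an outer \<open>c\<close> and the inner \<open>r\<close>.\<close>
  have sand': "\<exists>k. \<forall>f. c (ga_act n a' (ga_act n a (c (r f)))) = poly_scale k (c (r f))" for a a'
    using sand(1)[of "ga_mult n a' (ga_mult n a ce)"] by (simp add: ga_act_mult flip: c_ga)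
  have ann: "ga_act n a (c (r x)) = 0 \<longleftrightarrow> ga_act n a (c (r (c x))) = 0" for a
  proof
    assume *: "ga_act n a (c (r x)) = 0"
    let ?U = "cyc n (ga_act n a (c (r (c x))))"
    show "ga_act n a (c (r (c x))) = 0"
    proof (rule inner[OF invariant_cyc _ _ gen_in_cyc])
      show "?U \<subseteq> cyc n (r (c x))"
        by (intro cyc_subset invariant_cyc invariant_ga_act crc_in)
      fix f assume "f \<in> ?U"
      then obtain a' where f: "f = ga_act n a' (ga_act n a (c (r (c x))))"
        by (auto simp: cyc_def)
      obtain k where k: "\<And>f. c (ga_act n a' (ga_act n a (c (r f)))) = poly_scale k (c (r f))"
        using sand' by blast
      \<comment> \<open>The scalar is determined at \<open>f = x\<close>, where the left side
        vanishes and \<open>c r x\<close> does not, and is then used at \<open>f = c x\<close>. The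
        converse direction exchanges the two points.\<close>
      have "k = 0"
        using k[of x] * nz by (simp add: c_ga mpol.scale_eq_0_iff)
      then show "c f = 0"
        using k[of "c x"] by (simp add: f)
    qed
  next
    assume *: "ga_act n a (c (r (c x))) = 0"
    let ?U = "cyc n (ga_act n a (c (r x)))"
    show "ga_act n a (c (r x)) = 0"
    proof (rule outer_c[OF invariant_cyc _ _ gen_in_cyc])
      show "?U \<subseteq> cyc n (c (r x))"
        by (intro cyc_subset invariant_cyc ga_act_in_cyc)
      fix f assume "f \<in> ?U"
      then obtain a' where f: "f = ga_act n a' (ga_act n a (c (r x)))"
        by (auto simp: cyc_def)
      obtain k where k: "\<And>f. c (ga_act n a' (ga_act n a (c (r f)))) = poly_scale k (c (r f))"
        using sand' by blast
      have "k = 0"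
        using k[of "c x"] * crc_nz by (simp add: c_ga mpol.scale_eq_0_iff)
      then show "c f = 0"
        using k[of x] by (simp add: f)
    qed
  qed
  \<comment> \<open>For the reverse inclusion, \<open>r\<close> cannot kill the submodule generated
    by \<open>c r c x\<close>, so \<open>r c r c x\<close> is nonzero; being a multiple of
    \<open>r c x\<close>, it recovers this generator.\<close>
  have cyc_eq: "cyc n (c (r (c x))) = cyc n (r (c x))"
  proof
    show "cyc n (c (r (c x))) \<subseteq> cyc n (r (c x))"
      by (intro cyc_subset invariant_cyc crc_in)
    then obtain f where f: "f \<in> cyc n (c (r (c x)))" "r f \<noteq> 0"
      using outer_r[OF invariant_cyc _ _ gen_in_cyc] crc_nz by blast
    then obtain a where "f = ga_act n a (c (r (c x)))"
      by (auto simp: cyc_def)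
    then have "r (c (r (c x))) \<noteq> 0"
      using f(2) sand(2)[of a] by (metis mpol.scale_zero_right)
    moreover obtain k where k: "r (c (r (c x))) = poly_scale k (r (c x))"
      using sand(2)[of "ga_mult n ce re"] by (auto simp: ga_act_mult simp flip: c_ga r_ga)
    ultimately have "k \<noteq> 0"
      by auto
    then have "r (c x) = ga_act n (ga_scale (inverse k) re) (c (r (c x)))"
      using k by (simp add: ga_act_scale_left flip: r_ga)
    then have "r (c x) \<in> cyc n (c (r (c x)))"
      by (metis ga_act_in_cyc)
    then show "cyc n (r (c x)) \<subseteq> cyc n (c (r (c x)))"
      by (intro cyc_subset invariant_cyc)
  qed
  have ring: "poly_scale s (c (r x)) \<in> poly_ring n" "poly_scale s (c (r (c x))) \<in> poly_ring n"
    unfolding c_ga r_ga by (intro mpol.subspace_scale subspace_poly_ring ga_act_in_poly_ring x)+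
  \<comment> \<open>This covers \<open>s = 0\<close> as well: then both generators are zero and have
    the same annihilator.\<close>
  have "rep_isomorphic n (cyc n (poly_scale s (c (r x)))) (cyc n (poly_scale s (c (r (c x)))))"
    by (intro rep_isomorphic_cyc ring) (simp add: ga_act_scale_right mpol.scale_eq_0_iff ann)
  then show ?thesis
    unfolding cyc_scale cyc_eq by (simp add: c_def r_def)
qed

end


section \<open>Nonvanishing\<close>

definition exp_vec :: "nat \<Rightarrow> (nat \<Rightarrow> nat) \<Rightarrow> (nat \<Rightarrow>\<^sub>0 nat)" where
  "exp_vec n w = (\<Sum>e\<in>{1..n}. Poly_Mapping.single e (w e))"

lemma lookup_exp_vec: "lookup (exp_vec n w) e = (if e \<in> {1..n} then w e else 0)"
  by (simp add: exp_vec_def lookup_sum lookup_single when_def)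

lemma mon_act_exp_vec:
  assumes "g \<in> Sym n"
  shows "mon_act g (exp_vec n w) = exp_vec n (\<lambda>e. w (inv g e))"
  using Sym_in[OF Sym_inv[OF assms]]
  by (intro poly_mapping_eqI) (simp add: lookup_mon_act Sym_bij[OF assms] lookup_exp_vec)

lemma exp_vec_eq_iff: "exp_vec n w = exp_vec n w' \<longleftrightarrow> (\<forall>e\<in>{1..n}. w e = w' e)"
  by (auto simp: poly_mapping_eq_iff fun_eq_iff lookup_exp_vec)

text \<open>A pair contributes exactly when \<open>\<pi> \<circ> \<rho>\<close> fixes the monomial,
  here written with \<open>inv \<pi>\<close> on the other side.\<close>

lemma lookup_sym_op_sym_op:
  fixes m :: "nat \<Rightarrow>\<^sub>0 nat"
  assumes H: "H \<subseteq> Sym n" "H' \<subseteq> Sym n"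
  shows "lookup (sym_op b H (sym_op b' H' (Poly_Mapping.single m (1::'k::field)))) m =
    (\<Sum>\<pi>\<in>H. \<Sum>\<rho>\<in>H'. if mon_act \<rho> m = mon_act (inv \<pi>) m then ch b \<pi> * ch b' \<rho> else 0)"
proof -
  have bij: "bij \<pi>" if "\<pi> \<in> H \<union> H'" for \<pi>
    using H that Sym_bij by blast
  show ?thesis
    unfolding sym_op_def lookup_sum
    by (intro sum.cong refl)
       (simp add: lookup_perm_act bij lookup_sum sum_distrib_left perm_act_single lookup_single when_def
         if_distrib[of "(*) _"] cong: if_cong)
qed

context young_coords
begin

text \<open>Undoing a suitable inversion of \<open>\<kappa>\<close> increases the sum and fixes one more letter.\<close>

lemma rearrangement_less:
  assumes w: "\<And>e e'. \<lbrakk>e \<in> {1..n}; e' \<in> {1..n}; u e = u e'; v e < v e'\<rbrakk> \<Longrightarrow> w e < (w e' :: nat)"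
    and \<kappa>: "\<kappa> \<in> fib_group n u" "\<kappa> \<noteq> id"
  shows "(\<Sum>e\<in>{1..n}. v e * w (\<kappa> e)) < (\<Sum>e\<in>{1..n}. v e * w e)"
  using \<kappa>
proof (induction "card {e \<in> {1..n}. \<kappa> e \<noteq> e}" arbitrary: \<kappa> rule: less_induct)
  case less
  note \<kappa> = less.prems(1)
  have S: "\<kappa> \<in> Sym n"
    using \<kappa> by (simp add: fib_group_def)
  have inj: "\<kappa> a = \<kappa> b \<longleftrightarrow> a = b" for a b
    using Sym_bij[OF S] by (simp add: bij_is_inj inj_eq)
  have "\<exists>e. e \<in> {1..n} \<and> \<kappa> e \<noteq> e"
    using less.prems(2) permutes_not_in[OF Sym_permutes[OF S]] by (auto simp: fun_eq_iff)
  \<comment> \<open>Among the moved letters \<open>e\<close> has the least \<open>v\<close>, so its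
    image and its preimage, moved letters of the same line, lie beyond it.\<close>
  then obtain e where e: "e \<in> {1..n}" "\<kappa> e \<noteq> e"
    and least: "\<And>d. d \<in> {1..n} \<Longrightarrow> \<kappa> d \<noteq> d \<Longrightarrow> v e \<le> v d"
    using ex_has_least_nat[of "\<lambda>e. e \<in> {1..n} \<and> \<kappa> e \<noteq> e" _ v] by blast
  define e' where "e' = inv \<kappa> e"
  have ke': "\<kappa> e' = e"
    using Sym_bij[OF S] by (simp add: e'_def)
  have e'n: "e' \<in> {1..n}" "\<kappa> e \<in> {1..n}"
    using e Sym_in[OF S] Sym_in[OF Sym_inv[OF S]] by (auto simp: e'_def)
  have uu: "u e' = u e" "u (\<kappa> e) = u e"
    using \<kappa> e e'n ke' unfolding fib_group_def by force+
  have gt: "v e < v d" if "d \<in> {1..n}" "u d = u e" "\<kappa> d \<noteq> d" "d \<noteq> e" for d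
    using least[OF that(1,3)] coords_inj[OF that(1) e(1) that(2)] that(4) by fastforce
  have ne: "e' \<noteq> e" "\<kappa> e' \<noteq> e'" "\<kappa> (\<kappa> e) \<noteq> \<kappa> e"
    using ke' e(2) inj by auto
  have vlt: "v e < v e'" "v e < v (\<kappa> e)"
    using gt[of e'] gt[of "\<kappa> e"] e'n uu ne e(2) by auto
  \<comment> \<open>The position \<open>e'\<close> lies beyond \<open>e\<close> but receives the
    smaller value \<open>w e\<close>: this is the inversion to undo.\<close>
  then have "w (\<kappa> e') < w (\<kappa> e)"
    using w[OF e(1) e'n(2)] uu by (simp add: ke')
  then have lt: "(\<Sum>d\<in>{1..n}. v d * w (\<kappa> d)) < (\<Sum>d\<in>{1..n}. v d * w (\<kappa> (transpose e e' d)))"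
    using sum_less_transpose[of "{1..n}" e e' v "\<lambda>d. w (\<kappa> d)"] e(1) e'n(1) vlt(1) by simp
  let ?\<kappa> = "\<kappa> \<circ> transpose e e'"
  have "?\<kappa> \<in> fib_group n u"
    using perm_groupD(3)[OF perm_group_fib \<kappa> transpose_fib[OF e(1) e'n(1)]] uu by simp
  \<comment> \<open>The swap fixes \<open>e\<close>, and the other position it affects,
    \<open>e'\<close>, was already moved.\<close>
  moreover have "card {d \<in> {1..n}. ?\<kappa> d \<noteq> d} < card {d \<in> {1..n}. \<kappa> d \<noteq> d}"
  proof (rule psubset_card_mono)
    have "{d \<in> {1..n}. ?\<kappa> d \<noteq> d} \<subseteq> {d \<in> {1..n}. \<kappa> d \<noteq> d}"
      using ke' ne(2) by (auto simp: transpose_def split: if_splits)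
    moreover have "e \<in> {d \<in> {1..n}. \<kappa> d \<noteq> d}" "e \<notin> {d \<in> {1..n}. ?\<kappa> d \<noteq> d}"
      using e ke' by auto
    ultimately show "{d \<in> {1..n}. ?\<kappa> d \<noteq> d} \<subset> {d \<in> {1..n}. \<kappa> d \<noteq> d}"
      by blast
  qed simp
  ultimately have "?\<kappa> = id \<or> (\<Sum>d\<in>{1..n}. v d * w (?\<kappa> d)) < (\<Sum>d\<in>{1..n}. v d * w d)"
    using less.hyps[of ?\<kappa>] by blast
  then show ?case
  proof
    \<comment> \<open>The induction hypothesis excludes the identity, but then the single swap
      already reaches the target sum.\<close>
    assume "?\<kappa> = id"
    then have "\<kappa> (transpose e e' d) = d" for d
      by (metis comp_apply id_apply)
    then show ?thesis
      using lt by simp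
  qed (use lt in simp)
qed

text \<open>As \<open>\<rho>\<close> preserves \<open>v\<close>, the sum weighted by
  \<open>v\<close> is unchanged under \<open>\<rho>\<close>, whereas any \<open>\<kappa>\<close>
  other than the identity strictly lowers it.\<close>

lemma column_strict_rigid:
  assumes w: "\<And>e e'. \<lbrakk>e \<in> {1..n}; e' \<in> {1..n}; u e = u e'; v e < v e'\<rbrakk> \<Longrightarrow> w e < (w e' :: nat)"
    and \<kappa>: "\<kappa> \<in> fib_group n u" and \<rho>: "\<rho> \<in> fib_group n v"
    and eq: "\<And>e. e \<in> {1..n} \<Longrightarrow> w (\<kappa> e) = w (\<rho> e)"
  shows "\<kappa> = id"
proof (rule ccontr)
  assume "\<kappa> \<noteq> id"
  have "(\<Sum>e\<in>{1..n}. v e * w (\<kappa> e)) = (\<Sum>e\<in>{1..n}. v (\<rho> e) * w (\<rho> e))"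
    using eq \<rho> by (intro sum.cong refl) (simp add: fib_group_def)
  also have "\<dots> = (\<Sum>e\<in>{1..n}. v e * w e)"
    using sum.permute[of \<rho> "{1..n}" "\<lambda>e. v e * w e"] \<rho> by (simp add: fib_group_def Sym_def o_def)
  finally have "(\<Sum>e\<in>{1..n}. v e * w (\<kappa> e)) = (\<Sum>e\<in>{1..n}. v e * w e)" .
  moreover have "(\<Sum>e\<in>{1..n}. v e * w (\<kappa> e)) < (\<Sum>e\<in>{1..n}. v e * w e)"
    by (rule rearrangement_less[OF _ \<kappa> \<open>\<kappa> \<noteq> id\<close>]) (rule w)
  ultimately show False
    by simp
qed

text \<open>By rigidity only the identity of the group of \<open>u\<close> contributes to the
  coefficient of \<open>x\<close>. Its character is 1 for either \<open>b\<close>, and the other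
  operator carries no signs, so nothing cancels.\<close>

lemma symmetrizers_nonzero:
  assumes fact: "(of_nat (fact n) :: 'k::field) \<noteq> 0"
    and w: "\<And>e e'. \<lbrakk>e \<in> {1..n}; e' \<in> {1..n}; u e = u e'; v e < v e'\<rbrakk> \<Longrightarrow> w e < (w e' :: nat)"
    and x: "x = Poly_Mapping.single (exp_vec n w) (1::'k)"
  shows "sym_op b (fib_group n u) (sym_op False (fib_group n v) x) \<noteq> 0"
    and "sym_op False (fib_group n v) (sym_op b (fib_group n u) x) \<noteq> 0"
proof -
  note fib = perm_group_fib perm_groupD(5)[OF perm_group_fib] perm_groupD(6)[OF perm_group_fib]
  define K where "K = {\<rho> \<in> fib_group n v. mon_act \<rho> (exp_vec n w) = exp_vec n w}"
  have K: "perm_group n K"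
    unfolding perm_group_def K_def
  proof (intro conjI ballI subsetI)
    fix \<pi> assume "\<pi> \<in> {\<rho> \<in> fib_group n v. mon_act \<rho> (exp_vec n w) = exp_vec n w}"
    then have \<pi>: "\<pi> \<in> fib_group n v" "mon_act \<pi> (exp_vec n w) = exp_vec n w"
      by auto
    then show "\<pi> \<in> Sym n"
      using perm_groupD(1)[OF perm_group_fib] by blast
    then have "mon_act (inv \<pi>) (exp_vec n w) = exp_vec n w"
      using \<pi>(2) mon_act_eq_iff[OF Sym_bij, of \<pi> n] by metis
    then show "inv \<pi> \<in> {\<rho> \<in> fib_group n v. mon_act \<rho> (exp_vec n w) = exp_vec n w}"
      using \<pi> perm_groupD(4)[OF perm_group_fib] by blast
    fix \<rho> assume "\<rho> \<in> {\<rho> \<in> fib_group n v. mon_act \<rho> (exp_vec n w) = exp_vec n w}"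
    then have \<rho>: "\<rho> \<in> fib_group n v" "mon_act \<rho> (exp_vec n w) = exp_vec n w"
      by auto
    have "mon_act (\<pi> \<circ> \<rho>) (exp_vec n w) = exp_vec n w"
      using mon_act_comp[OF Sym_bij[OF perm_groupD(1)[OF perm_group_fib \<pi>(1)]]
        Sym_bij[OF perm_groupD(1)[OF perm_group_fib \<rho>(1)]]] \<pi>(2) \<rho>(2) by metis
    then show "\<pi> \<circ> \<rho> \<in> {\<rho> \<in> fib_group n v. mon_act \<rho> (exp_vec n w) = exp_vec n w}"
      using perm_groupD(3)[OF perm_group_fib \<pi>(1) \<rho>(1)] by blast
  qed (use perm_groupD(2)[OF perm_group_fib] in auto)
  have cK: "(of_nat (card K) :: 'k) \<noteq> 0"
    using card_perm_group_dvd[OF K] fact by (metis dvdE mult_zero_left of_nat_mult)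
  have count: "(\<Sum>\<rho>\<in>fib_group n v. if \<rho> \<in> K then 1 else (0::'k)) = of_nat (card K)"
    using fib(3) by (simp add: K_def sum.If_cases Int_def conj_commute)
  have rigid: "\<kappa> = id"
    if \<kappa>: "\<kappa> \<in> fib_group n u" and \<rho>: "\<rho> \<in> fib_group n v"
      and eq: "mon_act \<kappa> (exp_vec n w) = mon_act \<rho> (exp_vec n w)" for \<kappa> \<rho>
  proof -
    have S: "\<kappa> \<in> Sym n" "\<rho> \<in> Sym n"
      using perm_groupD(1)[OF perm_group_fib] \<kappa> \<rho> by blast+
    have "w (inv \<kappa> e) = w (inv \<rho> e)" if "e \<in> {1..n}" for e
      using eq that by (simp add: mon_act_exp_vec[OF S(1)] mon_act_exp_vec[OF S(2)] exp_vec_eq_iff)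
    \<comment> \<open>The action moves exponents by the inverse permutation, so rigidity is applied
      to the inverses.\<close>
    with w have "inv \<kappa> = id"
      by (rule column_strict_rigid[OF _ perm_groupD(4)[OF perm_group_fib \<kappa>]
        perm_groupD(4)[OF perm_group_fib \<rho>]])
    then show ?thesis
      using Sym_bij[OF S(1)] by (metis bij_inv_simps(5) inv_id)
  qed
  have inv_eq_id: "inv \<kappa> = id \<longleftrightarrow> \<kappa> = id" if "\<kappa> \<in> fib_group n u" for \<kappa>
    using Sym_bij[OF perm_groupD(1)[OF perm_group_fib that]] by (metis bij_inv_simps(5) inv_id)
  have K_iff: "\<rho> \<in> K \<longleftrightarrow> mon_act \<rho> (exp_vec n w) = exp_vec n w"
    "\<rho> \<in> K \<longleftrightarrow> exp_vec n w = mon_act (inv \<rho>) (exp_vec n w)" if "\<rho> \<in> fib_group n v" for \<rho>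
    using that mon_act_eq_iff[OF Sym_bij[OF perm_groupD(1)[OF perm_group_fib that]]]
    by (auto simp: K_def)
  have id: "id \<in> fib_group n u"
    by (rule perm_groupD(2)[OF perm_group_fib])
  have "lookup (sym_op b (fib_group n u) (sym_op False (fib_group n v) x)) (exp_vec n w) =
      (\<Sum>\<kappa>\<in>fib_group n u. if \<kappa> = id then (\<Sum>\<rho>\<in>fib_group n v. if \<rho> \<in> K then 1 else 0) else 0)"
    unfolding x lookup_sym_op_sym_op[OF fib(2) fib(2)]
  proof (intro sum.cong refl)
    fix \<kappa> assume \<kappa>: "\<kappa> \<in> fib_group n u"
    have "mon_act \<rho> (exp_vec n w) = mon_act (inv \<kappa>) (exp_vec n w) \<longleftrightarrow> \<kappa> = id \<and> \<rho> \<in> K"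
      if \<rho>: "\<rho> \<in> fib_group n v" for \<rho>
      using rigid[OF perm_groupD(4)[OF perm_group_fib \<kappa>] \<rho>] inv_eq_id[OF \<kappa>] K_iff(1)[OF \<rho>]
      by auto
    then show "(\<Sum>\<rho>\<in>fib_group n v. if mon_act \<rho> (exp_vec n w) = mon_act (inv \<kappa>) (exp_vec n w)
          then ch b \<kappa> * ch False \<rho> else 0) =
        (if \<kappa> = id then (\<Sum>\<rho>\<in>fib_group n v. if \<rho> \<in> K then 1 else (0::'k)) else 0)"
      by (auto simp: ch_def intro!: sum.cong)
  qed
  also have "\<dots> = of_nat (card K)"
    using id fib(3)[of n u] by (simp add: count)
  finally show "sym_op b (fib_group n u) (sym_op False (fib_group n v) x) \<noteq> 0"
    using cK by auto
  have "lookup (sym_op False (fib_group n v) (sym_op b (fib_group n u) x)) (exp_vec n w) =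
      (\<Sum>\<rho>\<in>fib_group n v. \<Sum>\<kappa>\<in>fib_group n u. if \<kappa> = id then if \<rho> \<in> K then 1 else 0 else 0)"
    unfolding x lookup_sym_op_sym_op[OF fib(2) fib(2)]
  proof (intro sum.cong refl)
    fix \<rho> \<kappa> assume \<rho>: "\<rho> \<in> fib_group n v" and \<kappa>: "\<kappa> \<in> fib_group n u"
    have "mon_act \<kappa> (exp_vec n w) = mon_act (inv \<rho>) (exp_vec n w) \<longleftrightarrow> \<kappa> = id \<and> \<rho> \<in> K"
      using rigid[OF \<kappa> perm_groupD(4)[OF perm_group_fib \<rho>]] K_iff(2)[OF \<rho>] by auto
    then show "(if mon_act \<kappa> (exp_vec n w) = mon_act (inv \<rho>) (exp_vec n w)
          then ch False \<rho> * ch b \<kappa> else 0) =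
        (if \<kappa> = id then if \<rho> \<in> K then 1 else (0::'k) else 0)"
      by (auto simp: ch_def)
  qed
  also have "\<dots> = of_nat (card K)"
    using id fib(3)[of n u] by (simp add: count)
  finally show "sym_op False (fib_group n v) (sym_op b (fib_group n u) x) \<noteq> 0"
    using cK by auto
qed

end


section \<open>The index of a standard tableau\<close>

text \<open>Row lengths decrease weakly, so the rows longer than \<open>j\<close> form an initial
  block and their number bounds the row index.\<close>

lemma col_height_iff:
  assumes "sorted_wrt (\<ge>) lam"
  shows "i < col_height lam j \<longleftrightarrow> (i, j) \<in> cells lam"
  using assms
proof (induction lam arbitrary: i)
  case (Cons a l)
  show ?case
  proof (cases "j < a")
    case True
    then show ?thesis
      using Cons by (cases i) (auto simp: col_height_def cells_def)
  next
    case False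
    then have "\<forall>r\<in>set l. \<not> j < r"
      using Cons.prems by auto
    then have "filter (\<lambda>r. j < r) l = []"
      by (simp add: filter_empty_conv)
    moreover have "\<not> j < l ! k" if "k < length l" for k
      using \<open>\<forall>r\<in>set l. \<not> j < r\<close> that by simp
    ultimately show ?thesis
      using False by (cases i) (auto simp: col_height_def cells_def)
  qed
qed (simp add: col_height_def cells_def)

section \<open>Reading words and indices\<close>

lemma right_of_trans:
  assumes "distinct w" "right_of w b a" "right_of w c b"
  shows "right_of w c a"
proof -
  obtain p q where pq: "p < q" "q < length w" "w ! p = a" "w ! q = b"
    using assms(2) by (auto simp: right_of_def)
  obtain r s where rs: "r < s" "s < length w" "w ! r = b" "w ! s = c"
    using assms(3) by (auto simp: right_of_def)
  have "q = r"
    using assms(1) pq rs nth_eq_iff_index_eq[of w q r] by simp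
  then show ?thesis
    unfolding right_of_def using pq rs by (intro exI[of _ p] exI[of _ s]) simp
qed

lemma right_of_asym:
  assumes "distinct w" "right_of w b a"
  shows "\<not> right_of w a b"
proof
  assume "right_of w a b"
  then have "right_of w a a"
    using right_of_trans[OF assms(1,2)] by blast
  then show False
    using assms(1) by (auto simp: right_of_def nth_eq_iff_index_eq)
qed

lemma right_of_append:
  assumes "right_of w b a"
  shows "right_of (xs @ w @ ys) b a"
proof -
  obtain p q where pq: "p < q" "q < length w" "w ! p = a" "w ! q = b"
    using assms by (auto simp: right_of_def)
  then show ?thesis
    unfolding right_of_def
    by (intro exI[of _ "length xs + p"] exI[of _ "length xs + q"]) (simp add: nth_append)
qed

lemma word_index_mono: "a \<le> b \<Longrightarrow> word_index w a \<le> word_index w b"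
proof (induction rule: dec_induct)
  case (step m)
  have "word_index w m \<le> word_index w (Suc m)"
    by (cases m) auto
  then show ?case
    using step.IH by simp
qed simp

text \<open>The index never decreases, so equal values at \<open>a\<close> and \<open>b\<close> rule
  out an increment between them; every single step then goes to the right, and these steps
  compose.\<close>

lemma word_index_eq_imp_right_of:
  assumes "distinct w" "1 \<le> a" "a < b" "word_index w a = word_index w b"
  shows "right_of w b a"
  using assms(3,4)
proof (induction b)
  case (Suc b)
  then obtain m where b: "b = Suc m"
    using assms(2) by (cases b) auto
  have "word_index w a \<le> word_index w b" "word_index w b \<le> word_index w (Suc b)"
    using Suc.prems(1) by (auto intro!: word_index_mono simp del: word_index.simps)
  then have eq: "word_index w a = word_index w b" "word_index w b = word_index w (Suc b)"
    using Suc.prems(2) by linarith+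
  then have step: "right_of w (Suc b) b"
    unfolding b by (auto split: if_splits)
  show ?case
  proof (cases "a = b")
    case False
    then have "right_of w b a"
      using Suc eq by simp
    then show ?thesis
      using right_of_trans[OF assms(1) _ step] by blast
  qed (use step in simp)
qed simp

lemma distinct_reading_word:
  assumes lam: "sorted_wrt (\<ge>) lam" and inj: "inj_on P (cells lam)"
  shows "distinct (reading_word lam P)"
proof -
  define cs where "cs = concat (map (\<lambda>j. map (\<lambda>i. (i, j)) (rev [0..<col_height lam j])) [0..<num_cols lam])"
  have "distinct (concat (map (\<lambda>j. map (\<lambda>i. (i, j)) (rev [0..<h j])) js))" if "distinct js"
    for js :: "nat list" and h :: "nat \<Rightarrow> nat"
    using that by (induction js) (auto simp: distinct_map inj_on_def)
  then have "distinct cs"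
    unfolding cs_def by simp
  moreover have "set cs \<subseteq> cells lam"
    unfolding cs_def using col_height_iff[OF lam] by auto
  moreover have "reading_word lam P = map P cs"
    unfolding reading_word_def cs_def by (simp add: map_concat o_def)
  ultimately show ?thesis
    using inj by (auto simp: distinct_map intro: inj_on_subset)
qed

lemma reading_word_column:
  assumes lam: "sorted_wrt (\<ge>) lam" and c: "(i', j) \<in> cells lam" and i: "i < i'"
  shows "right_of (reading_word lam P) (P (i, j)) (P (i', j))"
proof -
  have "j < num_cols lam"
    using c lam sorted_wrt_nth_less[OF lam, of 0 i']
    by (cases "i' = 0") (auto simp: cells_def num_cols_def hd_conv_nth)
  then have split: "[0..<num_cols lam] = [0..<j] @ j # [Suc j..<num_cols lam]"
    by (metis less_imp_le_nat upt_add_eq_append upt_conv_Cons zero_le le_add_diff_inverse plus_nat.add_0)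
  have h: "i' < col_height lam j"
    using col_height_iff[OF lam] c by simp
  \<comment> \<open>Read from bottom to top, row \<open>i\<close> stands at position
    \<open>col_height lam j - Suc i\<close>, so upper cells come later.\<close>
  have "right_of (map (\<lambda>i. P (i, j)) (rev [0..<col_height lam j])) (P (i, j)) (P (i', j))"
    unfolding right_of_def using h i
    by (intro exI[of _ "col_height lam j - Suc i'"] exI[of _ "col_height lam j - Suc i"])
       (auto simp: rev_nth)
  then show ?thesis
    unfolding reading_word_def split by (simp add: right_of_append)
qed

section \<open>Tableaux as permutations of a fixed tableau\<close>

text \<open>An injective map of a finite fibre into itself is onto.\<close>

lemma setwise_fib_iff:
  assumes \<sigma>: "\<sigma> \<in> Sym n"
  shows "(\<forall>i. \<sigma> ` {e \<in> {1..n}. u e = i} = {e \<in> {1..n}. u e = i}) \<longleftrightarrow> \<sigma> \<in> fib_group n u"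
proof
  assume *: "\<forall>i. \<sigma> ` {e \<in> {1..n}. u e = i} = {e \<in> {1..n}. u e = i}"
  have "u (\<sigma> e) = u e" if "e \<in> {1..n}" for e
    using *[rule_format, of "u e"] that by blast
  then show "\<sigma> \<in> fib_group n u"
    using \<sigma> by (simp add: fib_group_def)
next
  assume f: "\<sigma> \<in> fib_group n u"
  show "\<forall>i. \<sigma> ` {e \<in> {1..n}. u e = i} = {e \<in> {1..n}. u e = i}"
  proof
    fix i
    have "\<sigma> ` {e \<in> {1..n}. u e = i} \<subseteq> {e \<in> {1..n}. u e = i}"
      using f Sym_in[OF \<sigma>] by (auto simp: fib_group_def)
    then show "\<sigma> ` {e \<in> {1..n}. u e = i} = {e \<in> {1..n}. u e = i}"
      by (intro endo_inj_surj inj_on_subset[OF bij_is_inj[OF Sym_bij[OF \<sigma>]]]) auto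
  qed
qed

text \<open>With \<open>L\<close> the rows or columns of a translated tableau, its group is the
  conjugate by \<open>g\<close> of the group of the fixed tableau.\<close>

lemma setwise_conj_fib:
  assumes g: "g \<in> Sym n" and L: "\<And>i. L i = g ` {e \<in> {1..n}. u e = i}"
  shows "{\<pi> \<in> Sym n. \<forall>i. \<pi> ` L i = L i} = (\<lambda>\<pi>. g \<circ> \<pi> \<circ> inv g) ` fib_group n u"
proof -
  note bg = Sym_bij[OF g]
  have *: "(\<forall>i. \<pi> ` L i = L i) \<longleftrightarrow> inv g \<circ> \<pi> \<circ> g \<in> fib_group n u" if "\<pi> \<in> Sym n" for \<pi>
  proof -
    have "\<pi> ` L i = L i \<longleftrightarrow> (inv g \<circ> \<pi> \<circ> g) ` {e \<in> {1..n}. u e = i} = {e \<in> {1..n}. u e = i}" for i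
    proof -
      have "\<pi> ` L i = L i \<longleftrightarrow> inv g ` \<pi> ` L i = inv g ` L i"
        using bg by (simp add: inj_image_eq_iff bij_is_inj)
      also have "inv g ` L i = {e \<in> {1..n}. u e = i}"
        unfolding L using bg by (simp add: image_image)
      finally show ?thesis
        unfolding L by (simp add: image_comp comp_assoc)
    qed
    then show ?thesis
      using setwise_fib_iff[of "inv g \<circ> \<pi> \<circ> g" n u] g that by (simp add: Sym_comp Sym_inv)
  qed
  show ?thesis
  proof (intro equalityI subsetI)
    fix \<pi> assume "\<pi> \<in> {\<pi> \<in> Sym n. \<forall>i. \<pi> ` L i = L i}"
    then have "inv g \<circ> \<pi> \<circ> g \<in> fib_group n u"
      using * by auto
    moreover have "\<pi> = g \<circ> (inv g \<circ> \<pi> \<circ> g) \<circ> inv g"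
      using bg by (simp add: fun_eq_iff)
    ultimately show "\<pi> \<in> (\<lambda>\<pi>. g \<circ> \<pi> \<circ> inv g) ` fib_group n u"
      by blast
  next
    fix \<pi> assume "\<pi> \<in> (\<lambda>\<pi>. g \<circ> \<pi> \<circ> inv g) ` fib_group n u"
    then obtain \<sigma> where \<sigma>: "\<sigma> \<in> fib_group n u" "\<pi> = g \<circ> \<sigma> \<circ> inv g"
      by blast
    have "\<pi> \<in> Sym n"
      unfolding \<sigma>(2) using perm_groupD(1)[OF perm_group_fib \<sigma>(1)] g by (intro Sym_comp Sym_inv)
    moreover have "inv g \<circ> \<pi> \<circ> g = \<sigma>"
      unfolding \<sigma>(2) using bg by (simp add: fun_eq_iff)
    ultimately show "\<pi> \<in> {\<pi> \<in> Sym n. \<forall>i. \<pi> ` L i = L i}"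
      using * \<sigma>(1) by simp
  qed
qed

section \<open>The fixed tableau and its letters\<close>

locale standard_tableau =
  fixes lam :: "nat list" and n :: nat and P :: "nat \<times> nat \<Rightarrow> nat"
  assumes part: "partition_of lam n" and std: "P \<in> ST lam"
begin

definition pos :: "nat \<Rightarrow> nat \<times> nat" where "pos = inv_into (cells lam) P"

definition row :: "nat \<Rightarrow> nat" where "row e = fst (pos e)"

definition col :: "nat \<Rightarrow> nat" where "col e = snd (pos e)"

text \<open>The exponent of the variable with number \<open>e\<close> in the monomial of
  \<open>P\<close> with itself.\<close>

definition wt :: "nat \<Rightarrow> nat" where "wt e = index_tableau lam P (pos e)"

lemma sum_list: "sum_list lam = n" and sorted: "sorted_wrt (\<ge>) lam"
  using part by (auto simp: partition_of_def)

lemma bij_P: "bij_betw P (cells lam) {1..n}"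
  using std sum_list by (auto simp: ST_def tableaux_def)

lemma P_in: "c \<in> cells lam \<Longrightarrow> P c \<in> {1..n}"
  using bij_P by (auto simp: bij_betw_def)

lemma pos_P [simp]: "c \<in> cells lam \<Longrightarrow> pos (P c) = c"
  unfolding pos_def using bij_P by (simp add: bij_betw_def)

lemma pos_in: "e \<in> {1..n} \<Longrightarrow> pos e \<in> cells lam"
  unfolding pos_def using bij_P by (metis bij_betw_def inv_into_into)

lemma P_pos [simp]: "e \<in> {1..n} \<Longrightarrow> P (pos e) = e"
  unfolding pos_def using bij_P by (simp add: bij_betw_def f_inv_into_f)

lemma row_col: "pos e = (row e, col e)"
  by (simp add: row_def col_def)

lemma cells_down: "(i, j) \<in> cells lam \<Longrightarrow> i' \<le> i \<Longrightarrow> j' \<le> j \<Longrightarrow> (i', j') \<in> cells lam"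
  using sorted_wrt_nth_less[OF sorted, of i' i] by (cases "i' = i") (auto simp: cells_def)

lemma young_coords: "young_coords n col row"
proof
  fix e e' assume "e \<in> {1..n}" "e' \<in> {1..n}" "col e = col e'" "row e = row e'"
  then show "e = e'"
    using P_pos row_col by metis
next
  fix e i j assume e: "e \<in> {1..n}" "i \<le> col e" "j \<le> row e"
  then have c: "(j, i) \<in> cells lam"
    using cells_down pos_in[OF e(1)] row_col by metis
  then show "\<exists>e'\<in>{1..n}. col e' = i \<and> row e' = j"
    using P_in[OF c] by (intro bexI[of _ "P (j, i)"]) (simp_all add: row_def col_def)
qed

text \<open>In a column the upper entry is smaller but stands to the right of the lower one in the
  reading word. Equal indices would put the larger entry on the right.\<close>

lemma wt_strict:
  assumes e: "e \<in> {1..n}" "e' \<in> {1..n}" "col e = col e'" "row e < row e'"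
  shows "wt e < wt e'"
proof -
  define w where "w = reading_word lam P"
  have c: "(row e, col e) \<in> cells lam" "(row e', col e) \<in> cells lam"
    using pos_in[OF e(1)] pos_in[OF e(2)] row_col e(3) by metis+
  have P: "P (row e, col e) = e" "P (row e', col e) = e'"
    using P_pos e row_col by metis+
  have dist: "distinct w"
    unfolding w_def using bij_P by (intro distinct_reading_word sorted) (auto simp: bij_betw_def)
  have r: "right_of w e e'"
    using reading_word_column[OF sorted c(2) e(4), of P] P by (simp add: w_def)
  have "P (row e, col e) < P (row e', col e)"
    using std c e(4) unfolding ST_def by blast
  then have lt: "e < e'"
    by (simp add: P)
  then have "word_index w e \<noteq> word_index w e'"
    using word_index_eq_imp_right_of[OF dist, of e e'] right_of_asym[OF dist r] e(1) by auto
  then have "word_index w e < word_index w e'"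
    using word_index_mono[of e e' w] lt by simp
  then show ?thesis
    using e by (simp add: wt_def index_tableau_def w_def)
qed

text \<open>The restriction is needed because tableaux are extensional functions.\<close>

definition tab :: "(nat \<Rightarrow> nat) \<Rightarrow> nat \<times> nat \<Rightarrow> nat" where
  "tab g = restrict (g \<circ> P) (cells lam)"

lemma tableau_eq_tab:
  assumes "T \<in> tableaux lam"
  shows "\<exists>g\<in>Sym n. T = tab g"
proof -
  define g where "g e = (if e \<in> {1..n} then T (pos e) else e)" for e
  have T: "bij_betw T (cells lam) {1..n}" "T \<in> extensional (cells lam)"
    using assms sum_list by (auto simp: tableaux_def)
  have "bij_betw pos {1..n} (cells lam)"
    unfolding pos_def by (rule bij_betw_inv_into[OF bij_P])
  then have "bij_betw (T \<circ> pos) {1..n} {1..n}"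
    using T(1) by (rule bij_betw_trans)
  then have "bij_betw g {1..n} {1..n}"
    by (rule bij_betw_cong[THEN iffD1, rotated]) (simp add: g_def)
  then have "g \<in> Sym n"
    unfolding Sym_def by (auto intro!: bij_imp_permutes simp: g_def)
  moreover have "T c = tab g c" for c
    using extensional_arb[OF T(2)] P_in[of c] by (cases "c \<in> cells lam") (simp_all add: tab_def g_def)
  ultimately show ?thesis
    by blast
qed

lemma tab_tableau:
  assumes "g \<in> Sym n"
  shows "tab g \<in> tableaux lam"
proof -
  have "bij_betw (g \<circ> P) (cells lam) {1..n}"
    using bij_P Sym_permutes[OF assms] by (metis bij_betw_trans permutes_imp_bij)
  then have "bij_betw (tab g) (cells lam) {1..n}"
    by (rule bij_betw_cong[THEN iffD1, rotated]) (simp add: tab_def)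
  then show ?thesis
    by (simp add: tableaux_def sum_list) (simp add: tab_def)
qed

lemma tab_ST:
  assumes g: "g \<in> Sym n" and s: "std_labelling n col row g"
  shows "tab g \<in> ST lam"
proof -
  have st: "(col e = col e' \<and> row e < row e' \<longrightarrow> g e < g e') \<and> (row e = row e' \<and> col e < col e' \<longrightarrow> g e < g e')"
    if "e \<in> {1..n}" "e' \<in> {1..n}" for e e'
    using s that unfolding std_labelling_def by blast
  show ?thesis
    unfolding ST_def
  proof (intro CollectI conjI allI impI)
    fix i j j' assume "(i, j) \<in> cells lam \<and> (i, j') \<in> cells lam \<and> j < j'"
    then show "tab g (i, j) < tab g (i, j')"
      using st[OF P_in P_in, of "(i, j)" "(i, j')"] by (simp add: tab_def row_def col_def)
  next
    fix i i' j assume "(i, j) \<in> cells lam \<and> (i', j) \<in> cells lam \<and> i < i'"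
    then show "tab g (i, j) < tab g (i', j)"
      using st[OF P_in P_in, of "(i, j)" "(i', j)"] by (simp add: tab_def row_def col_def)
  qed (rule tab_tableau[OF g])
qed

lemma row_group_tab:
  assumes g: "g \<in> Sym n"
  shows "row_group lam (tab g) = (\<lambda>\<pi>. g \<circ> \<pi> \<circ> inv g) ` fib_group n row"
  unfolding row_group_def sum_list
proof (rule setwise_conj_fib[OF g], intro equalityI subsetI)
  fix i y assume "y \<in> row_entries lam (tab g) i"
  then obtain j where "(i, j) \<in> cells lam" "y = g (P (i, j))"
    by (auto simp: row_entries_def tab_def)
  then show "y \<in> g ` {e \<in> {1..n}. row e = i}"
    using P_in by (auto simp: row_def)
next
  fix i y assume "y \<in> g ` {e \<in> {1..n}. row e = i}"
  then obtain e where e: "e \<in> {1..n}" "row e = i" "y = g e"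
    by blast
  then have "(i, col e) \<in> cells lam" "P (i, col e) = e"
    using pos_in[OF e(1)] P_pos[OF e(1)] row_col by metis+
  then show "y \<in> row_entries lam (tab g) i"
    unfolding row_entries_def using e(3) by (intro CollectI exI[of _ "col e"]) (simp add: tab_def)
qed

lemma col_group_tab:
  assumes g: "g \<in> Sym n"
  shows "col_group lam (tab g) = (\<lambda>\<pi>. g \<circ> \<pi> \<circ> inv g) ` fib_group n col"
  unfolding col_group_def sum_list
proof (rule setwise_conj_fib[OF g], intro equalityI subsetI)
  fix j y assume "y \<in> col_entries lam (tab g) j"
  then obtain i where "(i, j) \<in> cells lam" "y = g (P (i, j))"
    by (auto simp: col_entries_def tab_def)
  then show "y \<in> g ` {e \<in> {1..n}. col e = j}"
    using P_in by (auto simp: col_def)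
next
  fix j y assume "y \<in> g ` {e \<in> {1..n}. col e = j}"
  then obtain e where e: "e \<in> {1..n}" "col e = j" "y = g e"
    by blast
  then have "(row e, j) \<in> cells lam" "P (row e, j) = e"
    using pos_in[OF e(1)] P_pos[OF e(1)] row_col by metis+
  then show "y \<in> col_entries lam (tab g) j"
    unfolding col_entries_def using e(3) by (intro CollectI exI[of _ "row e"]) (simp add: tab_def)
qed

definition base_monomial :: "'k::comm_ring_1 mpol" where
  "base_monomial = Poly_Mapping.single (exp_vec n wt) 1"

lemma index_monomial_tab:
  assumes g: "g \<in> Sym n"
  shows "index_monomial lam (tab g) P = perm_act g (base_monomial :: 'k::comm_ring_1 mpol)"
proof -
  have "(\<Sum>c\<in>cells lam. Poly_Mapping.single (tab g c) (index_tableau lam P c)) =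
      (\<Sum>c\<in>cells lam. Poly_Mapping.single (g (P c)) (wt (P c)))"
    by (intro sum.cong) (simp_all add: tab_def wt_def)
  also have "\<dots> = (\<Sum>e\<in>{1..n}. Poly_Mapping.single (g e) (wt e))"
    by (rule sum.reindex_bij_betw[OF bij_P])
  also have "\<dots> = (\<Sum>e\<in>{1..n}. Poly_Mapping.single e (wt (inv g e)))"
    using sum.permute[OF Sym_permutes[OF g], of "\<lambda>e. Poly_Mapping.single e (wt (inv g e))"]
      Sym_bij[OF g] by (simp add: o_def)
  also have "\<dots> = mon_act g (exp_vec n wt)"
    unfolding mon_act_exp_vec[OF g] by (simp add: exp_vec_def)
  finally show ?thesis
    using Sym_bij[OF g]
    by (simp add: index_monomial_def Var_power prod_single base_monomial_def perm_act_single)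
qed

lemma base_monomial_in: "(base_monomial :: 'k::comm_ring_1 mpol) \<in> poly_ring n"
  by (auto simp: poly_ring_def base_monomial_def in_keys_iff lookup_exp_vec split: if_splits)

text \<open>\<open>c r x\<close> for the fixed tableau, without the scalar
  \<open>young_coeff\<close>; \<open>msp\<close> is the analogue for \<open>r c x\<close>.\<close>

definition sp :: "'k::field mpol" where
  "sp = sym_op True (fib_group n col) (sym_op False (fib_group n row) base_monomial)"

definition msp :: "'k::field mpol" where
  "msp = sym_op False (fib_group n row) (sym_op True (fib_group n col) base_monomial)"

section \<open>Higher Specht polynomials as translates, and their spans\<close>

lemma col_antisym_eq: "col_antisym lam T = sym_elem True (col_group lam T)"
  by (auto simp: col_antisym_def sym_elem_def ch_def)

lemma row_sym_eq: "row_sym lam T = sym_elem False (row_group lam T)"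
  by (auto simp: row_sym_def sym_elem_def ch_def)

lemma group_subset: "row_group lam T \<subseteq> Sym n" "col_group lam T \<subseteq> Sym n"
  by (auto simp: row_group_def col_group_def sum_list)

lemma higher_specht_tab:
  assumes g: "g \<in> Sym n"
  shows "higher_specht lam (tab g) P = perm_act g (poly_scale (young_coeff lam) (sp :: 'k::field mpol))"
proof -
  have "higher_specht lam (tab g) P = poly_scale (young_coeff lam)
      (sym_op True (col_group lam (tab g)) (sym_op False (row_group lam (tab g))
        (perm_act g (base_monomial :: 'k mpol))))"
    unfolding higher_specht_def eps_def sum_list ga_act_scale_left ga_act_mult index_monomial_tab[OF g]
    by (simp add: sym_op_eq_ga_act[OF group_subset(1)] sym_op_eq_ga_act[OF group_subset(2)]
        col_antisym_eq row_sym_eq)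
  also have "\<dots> = poly_scale (young_coeff lam) (perm_act g sp)"
    unfolding sp_def row_group_tab[OF g] col_group_tab[OF g]
    by (simp add: sym_op_conj[OF perm_groupD(5)[OF perm_group_fib] g])
  finally show ?thesis
    by (simp add: perm_act_scale Sym_bij[OF g])
qed

lemma mod_higher_specht_tab:
  assumes g: "g \<in> Sym n"
  shows "mod_higher_specht lam (tab g) P = perm_act g (poly_scale (young_coeff lam) (msp :: 'k::field mpol))"
proof -
  have "mod_higher_specht lam (tab g) P = poly_scale (young_coeff lam)
      (sym_op False (row_group lam (tab g)) (sym_op True (col_group lam (tab g))
        (perm_act g (base_monomial :: 'k mpol))))"
    unfolding mod_higher_specht_def sig_def sum_list ga_act_scale_left ga_act_mult index_monomial_tab[OF g]
    by (simp add: sym_op_eq_ga_act[OF group_subset(1)] sym_op_eq_ga_act[OF group_subset(2)]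
        col_antisym_eq row_sym_eq)
  also have "\<dots> = poly_scale (young_coeff lam) (perm_act g msp)"
    unfolding msp_def row_group_tab[OF g] col_group_tab[OF g]
    by (simp add: sym_op_conj[OF perm_groupD(5)[OF perm_group_fib] g])
  finally show ?thesis
    by (simp add: perm_act_scale Sym_bij[OF g])
qed

text \<open>Common to both families: one inclusion holds because every tableau is some
  \<open>tab g\<close>, the other is the straightening supplied as \<open>garnir\<close>.\<close>

lemma span_ST_eq_cyc:
  fixes z :: "'k::field mpol"
  assumes F: "\<And>g. g \<in> Sym n \<Longrightarrow> F (tab g) = perm_act g z"
    and garnir: "\<And>g. g \<in> Sym n \<Longrightarrow>
      perm_act g z \<in> mpol.span {perm_act g' z | g'. g' \<in> Sym n \<and> std_labelling n col row g'}"
  shows "mpol.span {F T | T. T \<in> ST lam} = cyc n z"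
proof
  have "{F T | T. T \<in> ST lam} \<subseteq> {perm_act g z | g. g \<in> Sym n}"
  proof
    fix f assume "f \<in> {F T | T. T \<in> ST lam}"
    then obtain T where T: "f = F T" "T \<in> tableaux lam"
      by (auto simp: ST_def)
    then show "f \<in> {perm_act g z | g. g \<in> Sym n}"
      using tableau_eq_tab[OF T(2)] F by blast
  qed
  then show "mpol.span {F T | T. T \<in> ST lam} \<subseteq> cyc n z"
    unfolding cyc_eq_span by (rule mpol.span_mono)
  have "{perm_act g' z | g'. g' \<in> Sym n \<and> std_labelling n col row g'} \<subseteq> {F T | T. T \<in> ST lam}"
  proof
    fix f assume "f \<in> {perm_act g' z | g'. g' \<in> Sym n \<and> std_labelling n col row g'}"
    then obtain g where "g \<in> Sym n" "std_labelling n col row g" "f = perm_act g z"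
      by blast
    then show "f \<in> {F T | T. T \<in> ST lam}"
      using tab_ST[of g] F[of g] by (intro CollectI exI[of _ "tab g"]) simp
  qed
  then have "mpol.span {perm_act g' z | g'. g' \<in> Sym n \<and> std_labelling n col row g'}
      \<subseteq> mpol.span {F T | T. T \<in> ST lam}"
    by (rule mpol.span_mono)
  then show "cyc n z \<subseteq> mpol.span {F T | T. T \<in> ST lam}"
    unfolding cyc_eq_span using garnir by (intro mpol.span_minimal mpol.subspace_span) blast
qed

lemma N_space_eq:
  assumes "(of_nat (fact n) :: 'k::field) \<noteq> 0" "(2::'k) \<noteq> 0"
  shows "N_space lam P = cyc n (poly_scale (young_coeff lam) (sp :: 'k mpol))"
  unfolding N_space_def
proof (rule span_ST_eq_cyc[OF higher_specht_tab])
  let ?z = "poly_scale (young_coeff lam) (sp :: 'k mpol)"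
  \<comment> \<open>The scalar is moved onto the monomial, so that straightening applies even if it
    is zero.\<close>
  have z: "?z = sym_op True (fib_group n col)
      (sym_op (\<not> True) (fib_group n row) (poly_scale (young_coeff lam) base_monomial))"
    by (simp add: sp_def sym_op_scale[OF perm_groupD(5)[OF perm_group_fib]])
  show "perm_act g ?z \<in> mpol.span {perm_act g' ?z | g'. g' \<in> Sym n \<and> std_labelling n col row g'}"
    if "g \<in> Sym n" for g
    by (rule young_coords.standard_span[OF young_coords assms z that])
qed

lemma M_space_eq:
  assumes "(of_nat (fact n) :: 'k::field) \<noteq> 0" "(2::'k) \<noteq> 0"
  shows "M_space lam P = cyc n (poly_scale (young_coeff lam) (msp :: 'k mpol))"
  unfolding M_space_def
proof (rule span_ST_eq_cyc[OF mod_higher_specht_tab])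
  let ?z = "poly_scale (young_coeff lam) (msp :: 'k mpol)"
  have z: "?z = sym_op False (fib_group n row)
      (sym_op (\<not> False) (fib_group n col) (poly_scale (young_coeff lam) base_monomial))"
    by (simp add: msp_def sym_op_scale[OF perm_groupD(5)[OF perm_group_fib]])
  show "perm_act g ?z \<in> mpol.span {perm_act g' ?z | g'. g' \<in> Sym n \<and> std_labelling n col row g'}"
    if "g \<in> Sym n" for g
    \<comment> \<open>Standardness is symmetric in rows and columns, so the straightening for the
      conjugate diagram yields the same set of labellings.\<close>
    unfolding std_labelling_commute[of n col row]
    by (rule young_coords.standard_span[OF young_coords.swap[OF young_coords] assms z that])
qed

lemma rep_isomorphic_N_M:
  assumes fact: "(of_nat (fact n) :: 'k::field) \<noteq> 0" and two: "(2::'k) \<noteq> 0"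
  shows "rep_isomorphic n (N_space lam P :: 'k mpol set) (M_space lam P)"
proof -
  note nonzero = young_coords.symmetrizers_nonzero[OF young_coords fact _ base_monomial_def]
  have nz: "sym_op True (fib_group n col) (sym_op (\<not> True) (fib_group n row) (base_monomial :: 'k mpol)) \<noteq> 0"
    "sym_op (\<not> True) (fib_group n row) (sym_op True (fib_group n col) (base_monomial :: 'k mpol)) \<noteq> 0"
    unfolding not_True_eq_False by (rule nonzero, erule (3) wt_strict)+
  show ?thesis
    using young_coords.rep_isomorphic_symmetrizers[OF young_coords fact two base_monomial_in nz]
    unfolding N_space_eq[OF assms] M_space_eq[OF assms] sp_def msp_def by simp
qed

end

theorem theorem3p7:
  fixes n :: nat and lam :: "nat list" and P :: "nat \<times> nat \<Rightarrow> nat"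
  assumes "n \<ge> 3"
    and "\<not> CHAR('k::field) dvd fact n"
    and "partition_of lam n"
    and "P \<in> ST lam"
  shows "subrep n (N_space lam P :: 'k mpol set) \<and>
         rep_isomorphic n (N_space lam P :: 'k mpol set) (M_space lam P)"
proof -
  interpret standard_tableau lam n P
    using assms by unfold_locales
  have fact: "(of_nat (fact n) :: 'k) \<noteq> 0"
    using assms(2) by (simp only: of_nat_eq_0_iff_char_dvd not_False_eq_True)
  \<comment> \<open>This makes 2 nonzero in the field, as the sign argument of
    \<open>sym_op_vanish\<close> requires.\<close>
  have "2 dvd (fact n :: nat)"
    using assms(1) by (intro dvd_fact) auto
  then obtain m :: nat where "fact n = 2 * m"
    by (elim dvdE)
  then have "(of_nat (fact n) :: 'k) = 2 * of_nat m"
    by (simp only: of_nat_mult of_nat_numeral)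
  then have "(2::'k) \<noteq> 0"
    using fact by (metis mult_zero_left)
  then have "rep_isomorphic n (N_space lam P :: 'k mpol set) (M_space lam P)"
    by (rule rep_isomorphic_N_M[OF fact])
  then show ?thesis
    by (simp add: rep_isomorphic_def)
qed

end
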